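(* Let $K$ be a field, let $n_1<n_2<n_3<n_4$ be positive integers with $\gcd(n_1,n_2,n_3,n_4)=1$, and let $C$ be the monomial curve $x_i=t^{n_i}$ ($1\le i\le 4$) in $\mathbb{A}^4(K)$. Assume that $C$ is Gorenstein and not a complete intersection, and that $I(C)$ is minimally generated by $$f_1=x_1^{a_1}-x_3^{a_{13}}x_4^{a_{14}},\quad f_2=x_2^{a_2}-x_1^{a_{21}}x_3^{a_{23}},\quad f_3=x_3^{a_3}-x_2^{a_{32}}x_4^{a_{34}},$$ $$f_4=x_4^{a_4}-x_1^{a_{41}}x_2^{a_{42}},\quad f_5=x_1^{a_{21}}x_4^{a_{34}}-x_2^{a_{42}}x_3^{a_{13}},$$ where $a_i>1$ and $0<a_{ij}<a_j$ for all the exponents appearing. Suppose that $a_{21}+a_{34}<a_{42}+a_{13}$ and $a_{14}\le a_{34}$. If $a_2\le a_{21}+a_{23}$, $a_{32}+a_{34}\le a_3$ and $a_3+a_{13}\le a_1+a_{32}+a_{34}-a_{14}$, then $I(C)_*$ is minimally generated by the seven polynomials $$G_*=\{x_3^{a_{13}}x_4^{a_{14}},\ p_2,\ p_3,\ x_4^{a_4},\ x_1^{a_{21}}x_4^{a_{34}},\ p_6,\ p_7\},$$ where $p_2=x_2^{a_2}$ if $a_2<a_{21}+a_{23}$ and $p_2=x_2^{a_2}-x_1^{a_{21}}x_3^{a_{23}}$ if $a_2=a_{21}+a_{23}$; $p_3=x_2^{a_{32}}x_4^{a_{34}}$ if $a_{32}+a_{34}<a_3$ and $p_3=x_3^{a_3}-x_2^{a_{32}}x_4^{a_{34}}$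 if $a_{32}+a_{34}=a_3$; $p_6=x_3^{a_3+a_{13}}$ if $a_3+a_{13}<a_1+a_{32}+a_{34}-a_{14}$ and $p_6=x_3^{a_3+a_{13}}-x_1^{a_1}x_2^{a_{32}}x_4^{a_{34}-a_{14}}$ if $a_3+a_{13}=a_1+a_{32}+a_{34}-a_{14}$; $p_7=x_1^{a_1+a_{21}}x_4^{a_{34}-a_{14}}-x_2^{a_{42}}x_3^{2a_{13}}$ if both $a_2=a_{21}+a_{23}$ and $a_3+a_{13}=a_1+a_{32}+a_{34}-a_{14}$, and $p_7=x_2^{a_{42}}x_3^{2a_{13}}$ otherwise.
   Context: $I(C)$ is the kernel of the $K$-algebra homomorphism $\phi:K[x_1,\ldots,x_4]\to K[t]$, $\phi(x_i)=t^{n_i}$. $C$ is Gorenstein when the numerical semigroup generated by $n_1,\ldots,n_4$ is symmetric, and it is not a complete intersection when $I(C)$ cannot be generated by three elements. For $0\ne f\in I(C)$, $f_*$ denotes the homogeneous summand of $f$ of least (standard) degree, and $I(C)_*$ is the ideal of $K[x_1,\ldots,x_4]$ generated by all $f_*$, $f\in I(C)$; it is the defining ideal of the tangent cone of $C$ at the origin. In the described situation the exponents satisfy (Bresinsky) $a_1=a_{21}+a_{41}$, $a_2=a_{32}+a_{42}$, $a_3=a_{13}+a_{23}$, $a_4=a_{14}+a_{34}$. *)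

theory Defs
  imports "HOL-Library.Poly_Mapping" "HOL-Computational_Algebra.Polynomial"
begin

section \<open>The polynomial ring in four variables\<close>

datatype idx = I1 | I2 | I3 | I4

lemma UNIV_idx: "(UNIV :: idx set) = {I1, I2, I3, I4}"
  using idx.exhaust by auto

instance idx :: finite
  by standard (simp add: UNIV_idx)

lemma sum_idx: "(\<Sum>i\<in>(UNIV :: idx set). g i) = g I1 + g I2 + g I3 + (g I4 :: 'a::comm_monoid_add)"
  by (simp add: UNIV_idx add.assoc)

lemma prod_idx: "(\<Prod>i\<in>(UNIV :: idx set). g i) = g I1 * g I2 * g I3 * (g I4 :: 'a::comm_monoid_mult)"
  by (simp add: UNIV_idx mult.assoc)

text \<open>Finitely supported coefficient functions on exponent vectors; the multiplication of
  \<^theory>\<open>HOL-Library.Poly_Mapping\<close> is the convolution product.\<close>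

type_synonym expo = "idx \<Rightarrow>\<^sub>0 nat"
type_synonym 'k mpoly4 = "expo \<Rightarrow>\<^sub>0 'k"

definition var :: "idx \<Rightarrow> 'k::comm_ring_1 mpoly4" where
  "var i = Poly_Mapping.single (Poly_Mapping.single i 1) 1"

abbreviation x1 :: "'k::comm_ring_1 mpoly4" (\<open>x\<^sub>1\<close>) where "x\<^sub>1 \<equiv> var I1"
abbreviation x2 :: "'k::comm_ring_1 mpoly4" (\<open>x\<^sub>2\<close>) where "x\<^sub>2 \<equiv> var I2"
abbreviation x3 :: "'k::comm_ring_1 mpoly4" (\<open>x\<^sub>3\<close>) where "x\<^sub>3 \<equiv> var I3"
abbreviation x4 :: "'k::comm_ring_1 mpoly4" (\<open>x\<^sub>4\<close>) where "x\<^sub>4 \<equiv> var I4"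


section \<open>Ideals and generators\<close>

text \<open>A commutative ring as a module over itself: its submodules are the ideals, and
  \<open>ideal G\<close> is the ideal generated by \<open>G\<close>.\<close>

global_interpretation ideal: module "times :: 'a::comm_ring_1 \<Rightarrow> 'a \<Rightarrow> 'a"
  defines ideal = ideal.span
  by standard (simp_all add: algebra_simps)

text \<open>The generators form a list without repetitions, so that minimal generation by \<open>[g\<^sub>1, \<dots>, g\<^sub>r]\<close>
  includes that these are \<open>r\<close> different elements.\<close>

definition minimally_generated_by :: "'a::comm_ring_1 set \<Rightarrow> 'a list \<Rightarrow> bool" where
  "minimally_generated_by J gs \<longleftrightarrow>
     distinct gs \<and> ideal (set gs) = J \<and> (\<forall>g\<in>set gs. ideal (set gs - {g}) \<noteq> J)"


section \<open>Monomial curves in affine 4-space\<close>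

definition param_map :: "(idx \<Rightarrow> nat) \<Rightarrow> 'k::comm_ring_1 mpoly4 \<Rightarrow> 'k poly" where
  "param_map n f =
     (\<Sum>m\<in>Poly_Mapping.keys f.
        Polynomial.smult (Poly_Mapping.lookup f m)
          (\<Prod>i\<in>UNIV. Polynomial.monom 1 (n i) ^ Poly_Mapping.lookup m i))"

definition curve_ideal :: "(idx \<Rightarrow> nat) \<Rightarrow> 'k::comm_ring_1 mpoly4 set" where
  "curve_ideal n = {f. param_map n f = 0}"

definition semigroup_gen :: "(idx \<Rightarrow> nat) \<Rightarrow> nat set" where
  "semigroup_gen n = {s. \<exists>c. s = (\<Sum>i\<in>UNIV. c i * n i)}"

text \<open>The Frobenius number is taken in the integers: for \<open>S = \<nat>\<close> it is \<open>-1\<close>.  It is meaningful only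
  if \<open>S\<close> has finite complement in \<open>\<nat>\<close>.\<close>

definition frobenius_number :: "nat set \<Rightarrow> int" where
  "frobenius_number S = (GREATEST z. z \<notin> int ` S)"

definition symmetric_semigroup :: "nat set \<Rightarrow> bool" where
  "symmetric_semigroup S \<longleftrightarrow> (\<forall>z. z \<in> int ` S \<longleftrightarrow> frobenius_number S - z \<notin> int ` S)"

definition gorenstein_curve :: "(idx \<Rightarrow> nat) \<Rightarrow> bool" where
  "gorenstein_curve n \<longleftrightarrow> symmetric_semigroup (semigroup_gen n)"

text \<open>A curve in affine 4-space has codimension 3; the generators \<open>g\<^sub>1, g\<^sub>2, g\<^sub>3\<close> need not be distinct.\<close>

definition complete_intersection :: "'k::comm_ring_1 mpoly4 set \<Rightarrow> bool" where
  "complete_intersection J \<longleftrightarrow> (\<exists>g\<^sub>1 g\<^sub>2 g\<^sub>3. ideal {g\<^sub>1, g\<^sub>2, g\<^sub>3} = J)"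


section \<open>Initial forms and the tangent cone\<close>

definition mdeg :: "expo \<Rightarrow> nat" where
  "mdeg m = (\<Sum>i\<in>UNIV. Poly_Mapping.lookup m i)"

definition hom_component :: "nat \<Rightarrow> 'k::comm_ring_1 mpoly4 \<Rightarrow> 'k mpoly4" where
  "hom_component d f =
     (\<Sum>m\<in>{m \<in> Poly_Mapping.keys f. mdeg m = d}. Poly_Mapping.single m (Poly_Mapping.lookup f m))"

definition initial_form :: "'k::comm_ring_1 mpoly4 \<Rightarrow> 'k mpoly4" where
  "initial_form f = hom_component (LEAST d. hom_component d f \<noteq> 0) f"

definition initial_ideal :: "'k::comm_ring_1 mpoly4 set \<Rightarrow> 'k mpoly4 set" where
  "initial_ideal J = ideal {initial_form f |f. f \<in> J \<and> f \<noteq> 0}"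


section \<open>The parametrization is the intended algebra homomorphism\<close>

lemma param_map_superset:
  assumes "finite A" "Poly_Mapping.keys f \<subseteq> A"
  shows "param_map n f =
     (\<Sum>m\<in>A. Polynomial.smult (Poly_Mapping.lookup f m)
        (\<Prod>i\<in>UNIV. Polynomial.monom 1 (n i) ^ Poly_Mapping.lookup m i))"
  unfolding param_map_def
  by (rule sum.mono_neutral_left) (use assms in \<open>auto simp: in_keys_iff\<close>)

lemma param_map_single:
  "param_map n (Poly_Mapping.single m c) =
     Polynomial.smult c (\<Prod>i\<in>UNIV. Polynomial.monom 1 (n i) ^ Poly_Mapping.lookup m i)"
  by (subst param_map_superset[of "{m}"]) auto

lemma param_map_add: "param_map n (f + g) = param_map n f + param_map n g"
proof -
  let ?A = "Poly_Mapping.keys f \<union> Poly_Mapping.keys g"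
  have "Poly_Mapping.keys (f + g) \<subseteq> ?A"
    by (rule Poly_Mapping.keys_add)
  then show ?thesis
    by (simp add: param_map_superset[of ?A] lookup_add smult_add_left sum.distrib)
qed

lemma param_map_var: "param_map n (var i) = Polynomial.monom 1 (n i)"
proof -
  have "(\<Prod>j\<in>UNIV. Polynomial.monom (1::'a) (n j) ^ Poly_Mapping.lookup (Poly_Mapping.single i 1) j) =
        (\<Prod>j\<in>UNIV. if i = j then Polynomial.monom 1 (n j) else 1)"
    by (rule prod.cong) (auto simp: lookup_single)
  then show ?thesis
    by (simp add: var_def param_map_single)
qed

lemma param_map_const: "param_map n (Poly_Mapping.single 0 c) = [:c:]"
  by (simp add: param_map_single)

lemma param_map_sum: "finite A \<Longrightarrow> param_map n (sum f A) = (\<Sum>a\<in>A. param_map n (f a))"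
  by (induction A rule: finite_induct) (simp_all add: param_map_add, simp add: param_map_def)

lemma param_map_mult: "param_map n (f * g) = param_map n f * param_map n g"
proof -
  have expand: "h = (\<Sum>m\<in>Poly_Mapping.keys h. Poly_Mapping.single m (Poly_Mapping.lookup h m))"
    for h :: "'a mpoly4"
    by (rule poly_mapping_eqI)
      (auto simp: lookup_sum lookup_single when_def in_keys_iff)
  have mono: "param_map n (Poly_Mapping.single m c * Poly_Mapping.single m' c') =
      param_map n (Poly_Mapping.single m c) * param_map n (Poly_Mapping.single m' c')"
    for m m' and c c' :: 'a
    by (simp add: mult_single param_map_single lookup_add power_add prod.distrib mult.commute)
  define F where "F m = Poly_Mapping.single m (Poly_Mapping.lookup f m)" for m
  define G where "G m = Poly_Mapping.single m (Poly_Mapping.lookup g m)" for m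
  have f: "f = sum F (Poly_Mapping.keys f)" and g: "g = sum G (Poly_Mapping.keys g)"
    unfolding F_def G_def by (rule expand)+
  have "param_map n (F m * G m') = param_map n (F m) * param_map n (G m')" for m m'
    unfolding F_def G_def by (rule mono)
  then have "param_map n (sum F A * sum G B) = param_map n (sum F A) * param_map n (sum G B)"
    if "finite A" "finite B" for A B
    using that by (simp add: sum_product param_map_sum)
  then show ?thesis
    using f g by (metis finite_keys)
qed

end

theory Submission
  imports Defs "HOL-Library.Confluence"
begin

text \<open>The ideal \<open>I(C)\<close> is generated by binomials, so two monomials have the same weight
  \<open>\<Sum> m\<^sub>i n\<^sub>i\<close> if and only if they are connected by steps that replace one term of some \<open>f\<^sub>j\<close> by the
  other.  Orient \<open>f\<^sub>1, \<dots>, f\<^sub>5\<close> by nondecreasing degree and add \<open>f\<^sub>6 = x\<^sub>3\<^bsup>a\<^sub>3+a\<^sub>1\<^sub>3\<^esup> - x\<^sub>1\<^bsup>a\<^sub>1\<^esup>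
  x\<^sub>2\<^bsup>a\<^sub>3\<^sub>2\<^esup> x\<^sub>4\<^bsup>a\<^sub>3\<^sub>4-a\<^sub>1\<^sub>4\<^esup>\<close> and \<open>f\<^sub>7 = x\<^sub>2\<^bsup>a\<^sub>4\<^sub>2\<^esup> x\<^sub>3\<^bsup>2a\<^sub>1\<^sub>3\<^esup> - x\<^sub>1\<^bsup>a\<^sub>1+a\<^sub>2\<^sub>1\<^esup>
  x\<^sub>4\<^bsup>a\<^sub>3\<^sub>4-a\<^sub>1\<^sub>4\<^esup>\<close>.  The resulting rewriting system on monomials preserves weights, never decreases
  the degree, terminates, and is locally confluent because its twelve nontrivial critical pairs
  close.  So every weight has a unique normal form.  Along the reduction of a monomial to its normal
  form the degree either stays constant, and the two are congruent modulo the seven forms, or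
  increases, and the monomial lies in the ideal generated by them.  Applied to the
  monomials of least degree of some \<open>f \<in> I(C)\<close>, this puts the initial form of \<open>f\<close> into that ideal.
  The seven forms are minimal generators because each has a term that is divisible by no term of the
  others.

  The relations \<open>a\<^sub>1 = a\<^sub>2\<^sub>1 + a\<^sub>4\<^sub>1\<close> etc. follow from the weights of the \<open>f\<^sub>j\<close>, since \<open>x\<^sub>i\<^bsup>k\<^esup>\<close> with
  \<open>k < a\<^sub>i\<close> is divisible by no term of any \<open>f\<^sub>j\<close> and so is the only monomial of its weight.\<close>

section \<open>Terminating rewriting systems\<close>

text \<open>Newman's lemma, by well-founded induction. Local confluence joins the two first steps in
  \<open>u\<close>; the induction hypothesis at \<open>y'\<close> joins \<open>y\<close> with
  \<open>u\<close> in \<open>v\<close>, and at \<open>z'\<close> it joins \<open>v\<close> with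
  \<open>z\<close>.\<close>

lemma newman:
  assumes wf: "wf {(y, x). r x y}"
    and local: "\<And>x y z. r x y \<Longrightarrow> r x z \<Longrightarrow> \<exists>u. r\<^sup>*\<^sup>* y u \<and> r\<^sup>*\<^sup>* z u"
  shows "confluentp r"
proof (rule confluentpI)
  fix x y z
  assume "r\<^sup>*\<^sup>* x y" "r\<^sup>*\<^sup>* x z"
  then show "\<exists>u. r\<^sup>*\<^sup>* y u \<and> r\<^sup>*\<^sup>* z u"
    using wf
  proof (induction x arbitrary: y z rule: wf_induct_rule[OF wf])
    case (1 x)
    note IH = this
    show ?case
    proof (cases "x = y \<or> x = z")
      case True
      then show ?thesis using 1 by blast
    next
      case False
      obtain y' where y': "r x y'" "r\<^sup>*\<^sup>* y' y"
        using 1 False by (meson converse_rtranclpE)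
      obtain z' where z': "r x z'" "r\<^sup>*\<^sup>* z' z"
        using 1 False by (meson converse_rtranclpE)
      obtain u where u: "r\<^sup>*\<^sup>* y' u" "r\<^sup>*\<^sup>* z' u"
        using local y' z' by blast
      obtain v where v: "r\<^sup>*\<^sup>* y v" "r\<^sup>*\<^sup>* u v"
        using IH(1)[of y' y u] y' u wf by blast
      have "r\<^sup>*\<^sup>* z' v"
        using u v by (meson rtranclp_trans)
      then obtain w where w: "r\<^sup>*\<^sup>* v w" "r\<^sup>*\<^sup>* z w"
        using IH(1)[of z' v z] z' wf by blast
      then show ?thesis
        using v by (meson rtranclp_trans)
    qed
  qed
qed

lemma normal_form_exists:
  assumes wf: "wf {(y, x). r x y}"
  shows "\<exists>z. r\<^sup>*\<^sup>* x z \<and> (\<forall>w. \<not> r z w)"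
proof (induction x rule: wf_induct_rule[OF wf])
  case (1 x)
  then show ?case
    by (metis (mono_tags, lifting) case_prodI converse_rtranclp_into_rtranclp mem_Collect_eq rtranclp.rtrancl_refl)
qed

text \<open>A binomial \<open>x\<^sup>l - x\<^sup>r\<close> is encoded as the rewriting rule \<open>(l, r)\<close> on exponent vectors.\<close>

definition rstep :: "('a::comm_monoid_add \<times> 'a) set \<Rightarrow> 'a \<Rightarrow> 'a \<Rightarrow> bool" where
  "rstep R x y \<longleftrightarrow> (\<exists>l r u. (l, r) \<in> R \<and> x = l + u \<and> y = r + u)"

lemma rstep_add: "rstep R x y \<Longrightarrow> rstep R (x + u) (y + u)"
  unfolding rstep_def by (metis add.assoc)

lemma rsteps_add: "(rstep R)\<^sup>*\<^sup>* x y \<Longrightarrow> (rstep R)\<^sup>*\<^sup>* (x + u) (y + u)"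
  by (induction rule: rtranclp_induct) (auto intro: rstep_add rtranclp.rtrancl_into_rtrancl)

lemma rstep_rule: "(l, r) \<in> R \<Longrightarrow> rstep R l r"
  unfolding rstep_def by (metis add.right_neutral)

section \<open>Linear functionals as tests for membership in an ideal\<close>

abbreviation mon :: "expo \<Rightarrow> 'k::comm_ring_1 mpoly4" where
  "mon m \<equiv> Poly_Mapping.single m 1"

definition functional :: "(expo \<Rightarrow> 'k) \<Rightarrow> 'k::comm_ring_1 mpoly4 \<Rightarrow> 'k" where
  "functional g f = (\<Sum>m\<in>Poly_Mapping.keys f. Poly_Mapping.lookup f m * g m)"

lemma functional_superset:
  assumes "finite A" "Poly_Mapping.keys f \<subseteq> A"
  shows "functional g f = (\<Sum>m\<in>A. Poly_Mapping.lookup f m * g m)"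
  unfolding functional_def by (rule sum.mono_neutral_left) (use assms in \<open>auto simp: in_keys_iff\<close>)

lemma functional_zero [simp]: "functional g 0 = 0"
  by (simp add: functional_def)

lemma functional_add: "functional g (f + h) = functional g f + functional g h"
  using functional_superset[of "Poly_Mapping.keys f \<union> Poly_Mapping.keys h" "f + h" g]
    functional_superset[of "Poly_Mapping.keys f \<union> Poly_Mapping.keys h" f g]
    functional_superset[of "Poly_Mapping.keys f \<union> Poly_Mapping.keys h" h g] Poly_Mapping.keys_add[of f h]
  by (simp add: lookup_add algebra_simps sum.distrib)

lemma functional_uminus: "functional g (- f) = - functional g f"
  by (simp add: functional_def sum_negf)

lemma functional_diff: "functional g (f - h) = functional g f - functional g h"
  using functional_add[of g f "- h"] by (simp add: functional_uminus)

lemma functional_sum: "functional g (sum F A) = (\<Sum>a\<in>A. functional g (F a))"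
  by (induction A rule: infinite_finite_induct) (simp_all add: functional_add)

lemma functional_single [simp]: "functional g (Poly_Mapping.single m c) = c * g m"
  by (simp add: functional_def)

lemma single_sum: "(\<Sum>a\<in>A. Poly_Mapping.single k (F a)) = Poly_Mapping.single k (sum F A)"
  by (induction A rule: infinite_finite_induct) (simp_all add: single_add)

lemma mpoly_expand: "f = (\<Sum>m\<in>Poly_Mapping.keys f. Poly_Mapping.single m (Poly_Mapping.lookup f m))"
  by (rule poly_mapping_eqI) (auto simp: lookup_sum lookup_single when_def in_keys_iff)

lemma functional_mult_eq_0:
  assumes "\<And>u. functional g (mon u * f) = 0"
  shows "functional g (c * f) = 0"
proof -
  have single: "functional g (Poly_Mapping.single u k * f) = 0" for u k
  proof -
    have "functional g (Poly_Mapping.single u k * f) = functional g (\<Sum>m\<in>Poly_Mapping.keys f. Poly_Mapping.single (u + m) (k * Poly_Mapping.lookup f m))" for k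
      by (subst (1) mpoly_expand[of f]) (simp add: sum_distrib_left mult_single)
    then have e: "functional g (Poly_Mapping.single u k * f) = (\<Sum>m\<in>Poly_Mapping.keys f. k * Poly_Mapping.lookup f m * g (u + m))" for k
      by (simp add: functional_sum)
    have "functional g (Poly_Mapping.single u k * f) = k * functional g (mon u * f)"
      by (simp only: e mult_1 sum_distrib_left mult.assoc)
    then show ?thesis
      by (simp add: assms)
  qed
  have "functional g ((\<Sum>m\<in>Poly_Mapping.keys c. Poly_Mapping.single m (Poly_Mapping.lookup c m)) * f) = 0"
    by (simp only: sum_distrib_right functional_sum single sum.neutral_const)
  then show ?thesis
    by (simp only: mpoly_expand[of c, symmetric])
qed

text \<open>The kernel of a functional need not be an ideal, so the proof passes to the polynomials
  all of whose multiples are killed: these form an ideal, and it contains \<open>H\<close>.\<close>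

lemma functional_vanishes_on_ideal:
  assumes "\<And>h u. h \<in> H \<Longrightarrow> functional g (mon u * h) = 0" and "f \<in> ideal H"
  shows "functional g f = 0"
proof -
  let ?S = "{f. \<forall>c. functional g (c * f) = 0}"
  have "H \<subseteq> ?S"
    using assms(1) functional_mult_eq_0 by blast
  moreover have "ideal.subspace ?S"
    by (rule ideal.subspaceI) (simp_all add: distrib_left functional_add mult.assoc[symmetric])
  ultimately have "f \<in> ?S"
    using ideal.span_minimal assms(2) by blast
  then show ?thesis
    by (metis (mono_tags, lifting) mem_Collect_eq mult_1)
qed

text \<open>Test with the indicator function of the class of \<open>x\<close>. It kills every
  monomial multiple of a generator because both terms lie in the same class, so it kills
  \<open>mon x - mon y\<close>, which forces \<open>y\<close> into the class of
  \<open>x\<close>.\<close>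

lemma binomial_ideal_equiv:
  assumes "(mon x - mon y :: 'k::comm_ring_1 mpoly4) \<in> ideal {mon l - mon r |l r. (l, r) \<in> R}"
  shows "equivclp (rstep R) x y"
proof -
  define g :: "expo \<Rightarrow> 'k" where "g m = (if equivclp (rstep R) x m then 1 else 0)" for m
  have "functional g (mon x - mon y :: 'k mpoly4) = 0"
  proof (rule functional_vanishes_on_ideal[OF _ assms])
    fix h :: "'k mpoly4" and u
    assume "h \<in> {mon l - mon r |l r. (l, r) \<in> R}"
    then obtain l r where h: "h = mon l - mon r" and "(l, r) \<in> R"
      by blast
    then have eq: "equivclp (rstep R) (u + l) (u + r)"
      by (metis add.commute r_into_equivclp rstep_add rstep_rule)
    have "equivclp (rstep R) x (u + l) = equivclp (rstep R) x (u + r)"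
      by (rule iffI) (erule equivclp_trans, rule eq, erule equivclp_trans, rule equivclp_sym[OF eq])
    then have "g (u + l) = g (u + r)"
      by (simp add: g_def)
    then show "functional g (mon u * h) = 0"
      by (simp add: h functional_diff right_diff_distrib mult_single)
  qed
  then show ?thesis
    by (simp add: functional_diff g_def split: if_splits)
qed

text \<open>Every term of a multiple of \<open>h\<close> is a multiple of a term of
  \<open>h\<close>, so \<open>t\<close> never occurs. The functional used is the coefficient of
  \<open>t\<close>.\<close>

lemma coefficient_avoids_ideal:
  fixes f :: "'k::comm_ring_1 mpoly4"
  assumes "\<And>h m. h \<in> H \<Longrightarrow> m \<in> Poly_Mapping.keys h \<Longrightarrow> \<nexists>u. t = m + u"
    and "f \<in> ideal H"
  shows "Poly_Mapping.lookup f t = 0"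
proof -
  let ?g = "\<lambda>m. (1 when m = t)"
  have "Poly_Mapping.lookup f t = functional ?g f" for f :: "'k mpoly4"
    by (auto simp: functional_def when_def in_keys_iff if_distrib[of "(*) _"] sum.delta cong: if_cong)
  moreover have "functional ?g f = 0"
  proof (rule functional_vanishes_on_ideal[OF _ assms(2)])
    fix h u
    assume "h \<in> H"
    have "Poly_Mapping.keys (mon u * h) \<subseteq> {m + u |m. m \<in> Poly_Mapping.keys h}"
      unfolding mult.commute[of "mon u"] using keys_mult[of h "mon u"] by (auto split: if_splits)
    with \<open>h \<in> H\<close> have "t \<notin> Poly_Mapping.keys (mon u * h)"
      using assms(1) by blast
    then show "functional ?g (mon u * h) = 0"
      by (auto simp: functional_def when_def intro!: sum.neutral)
  qed
  ultimately show ?thesis by simp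
qed

section \<open>Weights and initial forms\<close>

definition wt :: "(idx \<Rightarrow> nat) \<Rightarrow> expo \<Rightarrow> nat" where
  "wt n m = (\<Sum>i\<in>UNIV. Poly_Mapping.lookup m i * n i)"

lemma wt_add: "wt n (u + v) = wt n u + wt n v"
  by (simp add: wt_def lookup_add algebra_simps sum.distrib)

lemma mdeg_add: "mdeg (u + v) = mdeg u + mdeg v"
  by (simp add: mdeg_def lookup_add sum.distrib)

lemma param_map_monomial: "param_map n (Poly_Mapping.single m c) = Polynomial.monom c (wt n m)"
proof -
  have "(\<Prod>i\<in>A. Polynomial.monom 1 (n i) ^ Poly_Mapping.lookup m i) =
      Polynomial.monom (1::'a) (\<Sum>i\<in>A. Poly_Mapping.lookup m i * n i)" for A
    by (induction A rule: infinite_finite_induct)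
      (simp_all add: monom_power mult_monom mult.commute)
  then show ?thesis
    by (simp add: param_map_single wt_def smult_monom)
qed

lemma coeff_param_map: "coeff (param_map n f) w = functional (\<lambda>m. if wt n m = w then 1 else 0) f"
proof -
  have "param_map n f = (\<Sum>m\<in>Poly_Mapping.keys f. Polynomial.monom (Poly_Mapping.lookup f m) (wt n m))"
    by (subst mpoly_expand[of f]) (simp add: param_map_sum param_map_monomial)
  then show ?thesis
    by (auto simp: functional_def coeff_sum intro!: sum.cong)
qed

lemma binomial_in_curve_ideal:
  "(mon u - mon v :: 'k::comm_ring_1 mpoly4) \<in> curve_ideal n \<longleftrightarrow> wt n u = wt n v"
proof -
  have "param_map n (mon u - mon v :: 'k mpoly4) = Polynomial.monom 1 (wt n u) - Polynomial.monom 1 (wt n v)"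
    using param_map_add[of n "mon u - mon v :: 'k mpoly4" "mon v"] by (simp add: param_map_monomial)
  then show ?thesis
    by (simp add: curve_ideal_def monom_eq_iff')
qed

text \<open>The coefficients of \<open>f\<close> in one weight add up to a coefficient of its image
  under \<open>param_map\<close>, which is zero, and \<open>g\<close> is constant on each weight.
  Scalars are written as constant polynomials \<open>Poly_Mapping.single 0 c\<close>.\<close>

lemma curve_ideal_weighted_sum:
  fixes f :: "'k::comm_ring_1 mpoly4"
  assumes f: "f \<in> curve_ideal n" and g: "\<And>u v. wt n u = wt n v \<Longrightarrow> g u = g v"
  shows "(\<Sum>m\<in>Poly_Mapping.keys f. Poly_Mapping.single 0 (Poly_Mapping.lookup f m) * g m) = (0 :: 'k mpoly4)"
proof -
  let ?K = "Poly_Mapping.keys f"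
  have "(\<Sum>m\<in>?K. Poly_Mapping.single 0 (Poly_Mapping.lookup f m) * g m) =
    (\<Sum>w\<in>wt n ` ?K. \<Sum>m\<in>{m \<in> ?K. wt n m = w}. Poly_Mapping.single 0 (Poly_Mapping.lookup f m) * g m)"
    by (rule sum.image_gen) simp
  also have "\<dots> = 0"
  proof (rule sum.neutral, rule ballI)
    fix w
    assume "w \<in> wt n ` ?K"
    then obtain v where w: "w = wt n v" by blast
    have "(\<Sum>m\<in>{m \<in> ?K. wt n m = w}. Poly_Mapping.single 0 (Poly_Mapping.lookup f m) * g m) =
        (\<Sum>m\<in>{m \<in> ?K. wt n m = w}. Poly_Mapping.single 0 (Poly_Mapping.lookup f m)) * g v"
      unfolding sum_distrib_right
    proof (rule sum.cong[OF refl])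
      fix m
      assume "m \<in> {m \<in> ?K. wt n m = w}"
      then have "g m = g v"
        using g w by blast
      then show "Poly_Mapping.single 0 (Poly_Mapping.lookup f m) * g m = Poly_Mapping.single 0 (Poly_Mapping.lookup f m) * g v"
        by simp
    qed
    also have "(\<Sum>m\<in>{m \<in> ?K. wt n m = w}. Poly_Mapping.single 0 (Poly_Mapping.lookup f m)) =
       Poly_Mapping.single (0::expo) (\<Sum>m\<in>{m \<in> ?K. wt n m = w}. Poly_Mapping.lookup f m)"
      by (rule single_sum)
    also have "(\<Sum>m\<in>{m \<in> ?K. wt n m = w}. Poly_Mapping.lookup f m) = coeff (param_map n f) w"
      unfolding coeff_param_map functional_def
      by (simp add: sum.inter_filter if_distrib[of "(*) _"] cong: if_cong)
    finally show "(\<Sum>m\<in>{m \<in> ?K. wt n m = w}. Poly_Mapping.single 0 (Poly_Mapping.lookup f m) * g m) = 0"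
      using f by (simp add: curve_ideal_def)
  qed
  finally show ?thesis .
qed

lemma lookup_hom_component:
  "Poly_Mapping.lookup (hom_component d f) m = (Poly_Mapping.lookup f m when mdeg m = d)"
  by (auto simp: hom_component_def lookup_sum lookup_single when_def in_keys_iff)

lemma hom_component_least:
  assumes "d = (LEAST d. hom_component d f \<noteq> 0)" and "m \<in> Poly_Mapping.keys f"
  shows "d \<le> mdeg m"
proof -
  have "Poly_Mapping.lookup (hom_component (mdeg m) f) m \<noteq> 0"
    using assms(2) by (simp add: lookup_hom_component in_keys_iff)
  then have "hom_component (mdeg m) f \<noteq> 0"
    by auto
  then show ?thesis
    unfolding assms(1) by (rule Least_le)
qed

lemma initial_form_binomial:
  assumes "l \<noteq> r" "mdeg l \<le> mdeg r"
  shows "initial_form (mon l - mon r :: 'k::comm_ring_1 mpoly4) =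
    (if mdeg l < mdeg r then mon l else mon l - mon r)"
proof -
  let ?f = "mon l - mon r :: 'k mpoly4"
  have l: "Poly_Mapping.lookup (hom_component (mdeg l) ?f) l = 1"
    using assms by (simp add: lookup_hom_component lookup_minus lookup_single)
  have "(LEAST d. hom_component d ?f \<noteq> 0) = mdeg l"
  proof (rule Least_equality)
    show "hom_component (mdeg l) ?f \<noteq> 0"
      using l by auto
    fix d
    assume "hom_component d ?f \<noteq> 0"
    then obtain m where "Poly_Mapping.lookup (hom_component d ?f) m \<noteq> 0"
      by (metis lookup_zero poly_mapping_eqI)
    then show "mdeg l \<le> d"
      using assms by (auto simp: lookup_hom_component lookup_minus lookup_single when_def split: if_splits)
  qed
  then show ?thesis
    using assms by (auto simp: initial_form_def lookup_hom_component lookup_minus lookup_single when_def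
        intro!: poly_mapping_eqI)
qed

section \<open>Rewriting of exponent vectors\<close>

definition expo4 :: "nat \<Rightarrow> nat \<Rightarrow> nat \<Rightarrow> nat \<Rightarrow> expo" where
  "expo4 p q r s = Poly_Mapping.single I1 p + Poly_Mapping.single I2 q +
     Poly_Mapping.single I3 r + Poly_Mapping.single I4 s"

lemma lookup_expo4 [simp]:
  "Poly_Mapping.lookup (expo4 p q r s) I1 = p" "Poly_Mapping.lookup (expo4 p q r s) I2 = q"
  "Poly_Mapping.lookup (expo4 p q r s) I3 = r" "Poly_Mapping.lookup (expo4 p q r s) I4 = s"
  by (simp_all add: expo4_def lookup_add lookup_single)

lemma all_idx: "(\<forall>i. P i) \<longleftrightarrow> P I1 \<and> P I2 \<and> P I3 \<and> P I4"
  by (metis idx.exhaust)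

lemma expo_eq_iff: "u = v \<longleftrightarrow> (\<forall>i. Poly_Mapping.lookup u i = Poly_Mapping.lookup v i)"
  for u v :: expo
  by (auto intro: poly_mapping_eqI)

lemma expo4_add: "expo4 p q r s + expo4 p' q' r' s' = expo4 (p + p') (q + q') (r + r') (s + s')"
  by (simp add: expo_eq_iff all_idx lookup_add)

lemma expo4_eq_iff [simp]: "expo4 p q r s = expo4 p' q' r' s' \<longleftrightarrow> p = p' \<and> q = q' \<and> r = r' \<and> s = s'"
  by (simp add: expo_eq_iff all_idx)

lemma mdeg_expo4 [simp]: "mdeg (expo4 p q r s) = p + q + r + s"
  by (simp add: mdeg_def sum_idx)

lemma wt_expo4: "wt n (expo4 p q r s) = p * n I1 + q * n I2 + r * n I3 + s * n I4"
  by (simp add: wt_def sum_idx)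

lemma expo4_divides:
  "(\<exists>u. expo4 p q r s = expo4 p' q' r' s' + u) \<longleftrightarrow> p' \<le> p \<and> q' \<le> q \<and> r' \<le> r \<and> s' \<le> s"
proof
  assume "\<exists>u. expo4 p q r s = expo4 p' q' r' s' + u"
  then show "p' \<le> p \<and> q' \<le> q \<and> r' \<le> r \<and> s' \<le> s"
    by (auto simp: expo_eq_iff all_idx lookup_add)
next
  assume "p' \<le> p \<and> q' \<le> q \<and> r' \<le> r \<and> s' \<le> s"
  then have "expo4 p q r s = expo4 p' q' r' s' + expo4 (p - p') (q - q') (r - r') (s - s')"
    by (simp add: expo4_add)
  then show "\<exists>u. expo4 p q r s = expo4 p' q' r' s' + u" ..
qed

lemma expo4_not_divides:
  "(\<forall>u. expo4 p q r s \<noteq> expo4 p' q' r' s' + u) \<longleftrightarrow> \<not> (p' \<le> p \<and> q' \<le> q \<and> r' \<le> r \<and> s' \<le> s)"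
  unfolding expo4_divides[symmetric] by simp

lemma var_power: "var i ^ k = mon (Poly_Mapping.single i k)"
  by (induction k) (simp_all add: var_def mult_single flip: single_add)

text \<open>The result is described by equations between sums, so the rule itself introduces no
  truncated subtraction into the side conditions.\<close>

lemma rstep_expo4I:
  assumes "(expo4 l1 l2 l3 l4, expo4 r1 r2 r3 r4) \<in> R"
    and "l1 \<le> p1" "l2 \<le> p2" "l3 \<le> p3" "l4 \<le> p4"
    and "q1 + l1 = p1 + r1" "q2 + l2 = p2 + r2" "q3 + l3 = p3 + r3" "q4 + l4 = p4 + r4"
  shows "rstep R (expo4 p1 p2 p3 p4) (expo4 q1 q2 q3 q4)"
  unfolding rstep_def
  by (intro exI[of _ "expo4 (p1 - l1) (p2 - l2) (p3 - l3) (p4 - l4)"] exI conjI, rule assms(1))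
    (use assms(2-) in \<open>auto simp: expo4_add\<close>)

section \<open>Critical pairs\<close>

definition joinable :: "('a \<Rightarrow> 'a \<Rightarrow> bool) \<Rightarrow> 'a \<Rightarrow> 'a \<Rightarrow> bool" where
  "joinable r x y \<longleftrightarrow> (\<exists>z. r\<^sup>*\<^sup>* x z \<and> r\<^sup>*\<^sup>* y z)"

lemma joinable_sym: "joinable r x y \<Longrightarrow> joinable r y x"
  by (auto simp: joinable_def)

lemma joinable_left: "r x y \<Longrightarrow> joinable r x y"
  by (auto simp: joinable_def)

lemma joinable_right: "r y x \<Longrightarrow> joinable r x y"
  by (auto simp: joinable_def)

lemma joinable_both: "r x z \<Longrightarrow> r y z \<Longrightarrow> joinable r x y"
  by (auto simp: joinable_def)

text \<open>All common multiples of the two left-hand sides are allowed here, which is what local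
  confluence asks for; \<open>confluent_peakI\<close> reduces the test to the least one.\<close>

definition confluent_peak :: "(expo \<times> expo) set \<Rightarrow> expo \<times> expo \<Rightarrow> expo \<times> expo \<Rightarrow> bool" where
  "confluent_peak R p q \<longleftrightarrow>
     (\<forall>u v. fst p + u = fst q + v \<longrightarrow> joinable (rstep R) (snd p + u) (snd q + v))"

lemma confluent_peak_refl: "confluent_peak R p p"
  by (auto simp: confluent_peak_def joinable_def)

lemma confluent_peak_sym: "confluent_peak R p q \<Longrightarrow> confluent_peak R q p"
  by (auto simp: confluent_peak_def intro: joinable_sym)

definition disjoint_support :: "expo \<Rightarrow> expo \<Rightarrow> bool" where
  "disjoint_support u v \<longleftrightarrow> (\<forall>i. Poly_Mapping.lookup u i = 0 \<or> Poly_Mapping.lookup v i = 0)"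

lemma disjoint_support_expo4 [simp]:
  "disjoint_support (expo4 p q r s) (expo4 p' q' r' s') \<longleftrightarrow>
     (p = 0 \<or> p' = 0) \<and> (q = 0 \<or> q' = 0) \<and> (r = 0 \<or> r' = 0) \<and> (s = 0 \<or> s' = 0)"
  by (simp add: disjoint_support_def all_idx)

text \<open>If \<open>b\<close> and \<open>c\<close> have disjoint supports, then \<open>l + b = l' + c\<close> is the least common multiple of
  \<open>l\<close> and \<open>l'\<close>.\<close>

lemma confluent_peakI:
  assumes eq: "l + b = l' + c"
    and disj: "disjoint_support b c"
    and join: "joinable (rstep R) (r + b) (r' + c)"
  shows "confluent_peak R (l, r) (l', r')"
  unfolding confluent_peak_def
proof (intro allI impI)
  fix u v
  assume "fst (l, r) + u = fst (l', r') + v"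
  then have uv: "Poly_Mapping.lookup l i + Poly_Mapping.lookup u i =
      Poly_Mapping.lookup l' i + Poly_Mapping.lookup v i" for i
    by (metis fst_conv lookup_add)
  have eq': "Poly_Mapping.lookup l i + Poly_Mapping.lookup b i =
      Poly_Mapping.lookup l' i + Poly_Mapping.lookup c i" for i
    using eq by (metis lookup_add)
  \<comment> \<open>At each index \<open>b\<close> or \<open>c\<close> vanishes; comparing
    \<open>uv\<close> with \<open>eq'\<close> then shows that the truncated difference
    \<open>u - b\<close> is exact and equals \<open>v - c\<close>.\<close>
  define z where "z = u - b"
  have "Poly_Mapping.lookup u i = Poly_Mapping.lookup b i + Poly_Mapping.lookup z i"
    "Poly_Mapping.lookup v i = Poly_Mapping.lookup c i + Poly_Mapping.lookup z i" for i
    using uv[of i] eq'[of i] disj[unfolded disjoint_support_def, rule_format, of i] by (auto simp: z_def lookup_minus)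
  then have "u = b + z" "v = c + z"
    by (simp_all add: expo_eq_iff lookup_add)
  moreover obtain w where "(rstep R)\<^sup>*\<^sup>* (r + b) w" "(rstep R)\<^sup>*\<^sup>* (r' + c) w"
    using join unfolding joinable_def by blast
  then have "joinable (rstep R) (r + b + z) (r' + c + z)"
    unfolding joinable_def by (blast intro: rsteps_add)
  ultimately show "joinable (rstep R) (snd (l, r) + u) (snd (l', r') + v)"
    by (simp only: snd_conv add.assoc)
qed

text \<open>The analogue of Buchberger's product criterion: \<open>r + l'\<close> rewrites by the
  second rule and \<open>r' + l\<close> by the first, both to \<open>r' + r\<close>.\<close>

lemma coprime_confluent_peak:
  assumes rules: "(l, r) \<in> R" "(l', r') \<in> R"
    and disj: "disjoint_support l l'"
  shows "confluent_peak R (l, r) (l', r')"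
proof (rule confluent_peakI)
  show "l + l' = l' + l"
    by (rule add.commute)
  show "disjoint_support l' l"
    using disj by (metis disjoint_support_def)
  have "rstep R (r + l') (r' + r)"
    using rstep_add[OF rstep_rule[OF rules(2)], of r] by (simp only: add.commute[of l' r])
  moreover have "rstep R (r' + l) (r' + r)"
    using rstep_add[OF rstep_rule[OF rules(1)], of r'] by (simp only: add.commute[of l r'] add.commute[of r r'])
  ultimately show "joinable (rstep R) (r + l') (r' + l)"
    by (rule joinable_both)
qed

lemma rstep_locally_confluent:
  assumes "\<And>p q. p \<in> R \<Longrightarrow> q \<in> R \<Longrightarrow> confluent_peak R p q"
    and "rstep R x y" "rstep R x z"
  shows "\<exists>u. (rstep R)\<^sup>*\<^sup>* y u \<and> (rstep R)\<^sup>*\<^sup>* z u"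
proof -
  obtain p u where p: "p \<in> R" "x = fst p + u" "y = snd p + u"
    using assms(2) by (force simp: rstep_def)
  obtain q v where q: "q \<in> R" "x = fst q + v" "z = snd q + v"
    using assms(3) by (force simp: rstep_def)
  have "fst p + u = fst q + v"
    using p(2) q(2) by simp
  then have "joinable (rstep R) y z"
    using assms(1)[OF p(1) q(1)] unfolding confluent_peak_def p(3) q(3) by blast
  then show ?thesis
    unfolding joinable_def .
qed

section \<open>The relations between the exponents\<close>

lemma equivclp_rstep_mono:
  assumes "\<And>l r. (l, r) \<in> B \<Longrightarrow> equivclp (rstep R) l r" and "equivclp (rstep B) x y"
  shows "equivclp (rstep R) x y"
proof -
  have add: "equivclp (rstep R) (x + u) (y + u)" if "equivclp (rstep R) x y" for x y u
    using that
  proof (induction rule: equivclp_induct)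
    case (step y z)
    then show ?case
      by (meson equivclp_into_equivclp rstep_add)
  qed simp
  have step: "equivclp (rstep R) x y" if "rstep B x y" for x y
    using that assms(1) add unfolding rstep_def by blast
  show ?thesis
    using assms(2)
  proof (induction rule: equivclp_induct)
    case (step y z)
    then show ?case
      using \<open>\<And>x y. rstep B x y \<Longrightarrow> equivclp (rstep R) x y\<close> by (meson equivclp_sym equivclp_trans)
  qed simp
qed

text \<open>No rule can be applied to \<open>x\<close> in either direction, so its class is a
  singleton.\<close>

lemma equivclp_rstep_isolated:
  assumes "equivclp (rstep B) x y"
    and "\<And>l r. (l, r) \<in> B \<Longrightarrow> (\<nexists>u. x = l + u) \<and> (\<nexists>u. x = r + u)"
  shows "y = x"
  using assms(1)
proof (induction rule: equivclp_induct)
  case (step y z)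
  then show ?case
    using assms(2) unfolding rstep_def by blast
qed simp

text \<open>A locale without assumptions, so that the assumptions of
  \<open>bresinsky_generators\<close> can mention \<open>binomials\<close>.\<close>

locale bresinsky_exponents =
  fixes a1 a2 a3 a4 a13 a14 a21 a23 a32 a34 a41 a42 :: nat
begin

definition binomials :: "(expo \<times> expo) set" where
  "binomials = {(expo4 a1 0 0 0, expo4 0 0 a13 a14), (expo4 0 a2 0 0, expo4 a21 0 a23 0),
      (expo4 0 0 a3 0, expo4 0 a32 0 a34), (expo4 0 0 0 a4, expo4 a41 a42 0 0),
      (expo4 a21 0 0 a34, expo4 0 a42 a13 0)}"

end

text \<open>The field is eliminated: \<open>weight\<close> expresses that the five binomials lie in
  I(C), and \<open>connected\<close> that they generate it.\<close>

locale bresinsky_generators =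
  bresinsky_exponents a1 a2 a3 a4 a13 a14 a21 a23 a32 a34 a41 a42
  for a1 a2 a3 a4 a13 a14 a21 a23 a32 a34 a41 a42 +
  fixes n :: "idx \<Rightarrow> nat"
  assumes n_pos: "0 < n I1" "0 < n I2" "0 < n I3" "0 < n I4"
    and pos: "0 < a13" "0 < a14" "0 < a21" "0 < a23" "0 < a32" "0 < a34" "0 < a41" "0 < a42"
    and bound: "a21 < a1" "a42 < a2" "0 < a3" "0 < a4"
    and weight: "\<And>l r. (l, r) \<in> binomials \<Longrightarrow> wt n l = wt n r"
    and connected: "\<And>u v. wt n u = wt n v \<Longrightarrow> equivclp (rstep binomials) u v"
begin

lemma weights:
  "a1 * n I1 = a13 * n I3 + a14 * n I4"
  "a2 * n I2 = a21 * n I1 + a23 * n I3"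
  "a3 * n I3 = a32 * n I2 + a34 * n I4"
  "a4 * n I4 = a41 * n I1 + a42 * n I2"
  "a21 * n I1 + a34 * n I4 = a42 * n I2 + a13 * n I3"
  using weight[of "expo4 a1 0 0 0" "expo4 0 0 a13 a14"] weight[of "expo4 0 a2 0 0" "expo4 a21 0 a23 0"]
    weight[of "expo4 0 0 a3 0" "expo4 0 a32 0 a34"] weight[of "expo4 0 0 0 a4" "expo4 a41 a42 0 0"]
    weight[of "expo4 a21 0 0 a34" "expo4 0 a42 a13 0"]
  by (simp_all add: binomials_def wt_expo4)

lemma pure_power_isolated:
  "wt n (expo4 k 0 0 0) = wt n v \<Longrightarrow> k < a1 \<Longrightarrow> v = expo4 k 0 0 0"
  "wt n (expo4 0 k 0 0) = wt n v \<Longrightarrow> k < a2 \<Longrightarrow> v = expo4 0 k 0 0"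
  "wt n (expo4 0 0 k 0) = wt n v \<Longrightarrow> k < a3 \<Longrightarrow> v = expo4 0 0 k 0"
  "wt n (expo4 0 0 0 k) = wt n v \<Longrightarrow> k < a4 \<Longrightarrow> v = expo4 0 0 0 k"
  by (erule equivclp_rstep_isolated[OF connected]; unfold binomials_def; elim insertE emptyE;
      use pos bound in \<open>simp add: expo4_divides\<close>)+

text \<open>By the weights of \<open>f1\<close> and \<open>f5\<close>, \<open>x4^(a14 + a34)\<close>
  has the weight of \<open>x1^(a1 - a21) x2^a42\<close>, so isolation gives
  \<open>a4 <= a14 + a34\<close>. Cancelling \<open>f4\<close> leaves a power of \<open>x1\<close>
  with exponent below \<open>a1\<close> that has the weight of a power of \<open>x4\<close>; by
  isolation both exponents vanish. The other two relations follow in the same way from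
  \<open>f2\<close>, \<open>f5\<close> and \<open>f3\<close>.\<close>

lemma exponent_relations: "a1 = a21 + a41" "a2 = a32 + a42" "a3 = a13 + a23" "a4 = a14 + a34"
proof -
  have "a1 * n I1 = a21 * n I1 + (a1 - a21) * n I1"
    using bound(1) by (simp flip: distrib_right)
  then have e4: "(a14 + a34) * n I4 = (a1 - a21) * n I1 + a42 * n I2"
    using weights(1,5) by (simp add: distrib_right)
  then have ge4: "a4 \<le> a14 + a34"
    using pure_power_isolated(4)[of "a14 + a34" "expo4 (a1 - a21) a42 0 0"] pos
    by (intro leI notI) (simp add: wt_expo4)
  then have "(a14 + a34) * n I4 = (a14 + a34 - a4) * n I4 + a4 * n I4"
    by (simp flip: distrib_right)
  then have "(a14 + a34 - a4) * n I4 + a41 * n I1 = (a1 - a21) * n I1"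
    using e4 weights(4) by linarith
  moreover from this have "a41 \<le> a1 - a21"
    using n_pos(1) by (metis le_add2 mult_le_cancel2)
  moreover from this have "(a1 - a21) * n I1 = (a1 - a21 - a41) * n I1 + a41 * n I1"
    by (metis add_mult_distrib le_add_diff_inverse2)
  ultimately have "(a1 - a21 - a41) * n I1 = (a14 + a34 - a4) * n I4"
    by linarith
  then have "expo4 0 0 0 (a14 + a34 - a4) = expo4 (a1 - a21 - a41) 0 0 0"
    using pos bound by (intro pure_power_isolated(1)) (simp_all add: wt_expo4)
  then show "a1 = a21 + a41" "a4 = a14 + a34"
    using \<open>a41 \<le> a1 - a21\<close> ge4 bound(1) by (simp, linarith, simp)
  have "a2 * n I2 = a42 * n I2 + (a2 - a42) * n I2"
    using bound(2) by (simp flip: distrib_right)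
  then have e3: "(a13 + a23) * n I3 = (a2 - a42) * n I2 + a34 * n I4"
    using weights(2,5) by (simp add: distrib_right)
  then have ge3: "a3 \<le> a13 + a23"
    using pure_power_isolated(3)[of "a13 + a23" "expo4 0 (a2 - a42) 0 a34"] pos
    by (intro leI notI) (simp add: wt_expo4)
  then have "(a13 + a23) * n I3 = (a13 + a23 - a3) * n I3 + a3 * n I3"
    by (simp flip: distrib_right)
  then have "(a13 + a23 - a3) * n I3 + a32 * n I2 = (a2 - a42) * n I2"
    using e3 weights(3) by linarith
  moreover from this have "a32 \<le> a2 - a42"
    using n_pos(2) by (metis le_add2 mult_le_cancel2)
  moreover from this have "(a2 - a42) * n I2 = (a2 - a42 - a32) * n I2 + a32 * n I2"
    by (metis add_mult_distrib le_add_diff_inverse2)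
  ultimately have "(a2 - a42 - a32) * n I2 = (a13 + a23 - a3) * n I3"
    by linarith
  then have "expo4 0 0 (a13 + a23 - a3) 0 = expo4 0 (a2 - a42 - a32) 0 0"
    using pos bound by (intro pure_power_isolated(2)) (simp_all add: wt_expo4)
  then show "a2 = a32 + a42" "a3 = a13 + a23"
    using \<open>a32 \<le> a2 - a42\<close> ge3 bound(2) by (simp, linarith, simp)
qed

end

section \<open>Initial ideals from complete rewriting systems\<close>

text \<open>For \<open>u\<close> different from \<open>v\<close> this says that the degree does not
  drop and that \<open>J\<close> contains the initial form of \<open>mon u - mon v\<close>.\<close>

definition degree_compatible :: "'k::comm_ring_1 mpoly4 set \<Rightarrow> expo \<Rightarrow> expo \<Rightarrow> bool" where
  "degree_compatible J u v \<longleftrightarrow>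
     mdeg u < mdeg v \<and> mon u \<in> J \<or> mdeg u = mdeg v \<and> mon u - mon v \<in> J"

text \<open>A first step that raises the degree already puts \<open>mon x\<close> into the ideal;
  one that keeps the degree makes \<open>x\<close> and \<open>y\<close> congruent, so what holds for
  \<open>y\<close> carries over to \<open>x\<close>.\<close>

lemma degree_compatible_rsteps:
  assumes rules: "\<And>l r. (l, r) \<in> R \<Longrightarrow> degree_compatible (ideal G) l r"
    and "(rstep R)\<^sup>*\<^sup>* u v"
  shows "degree_compatible (ideal G) u v"
  using assms(2)
proof (induction rule: converse_rtranclp_induct)
  case base
  then show ?case
    by (simp add: degree_compatible_def ideal.span_zero)
next
  case (step x y)
  then obtain l r w where w: "(l, r) \<in> R" "x = w + l" "y = w + r"
    unfolding rstep_def by (metis add.commute)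
  have "mon x \<in> ideal G" if "mon l \<in> ideal G"
    using ideal.span_scale[OF that, of "mon w"] by (simp add: w mult_single)
  moreover have "mon x - mon y \<in> ideal G" if "mon l - mon r \<in> ideal G"
    using ideal.span_scale[OF that, of "mon w"] by (simp add: w mult_single right_diff_distrib)
  ultimately have xy: "degree_compatible (ideal G) x y"
    using rules[OF w(1)] by (auto simp: degree_compatible_def w mdeg_add)
  have sum: "mon x \<in> ideal G" if "mon x - mon y \<in> ideal G" "mon y \<in> ideal G"
    using ideal.span_add[OF that] by simp
  have trans: "mon x - mon v \<in> ideal G" if "mon x - mon y \<in> ideal G" "mon y - mon v \<in> ideal G"
    using ideal.span_add[OF that] by simp
  show ?case
    using xy step.IH sum trans unfolding degree_compatible_def by auto
qed

text \<open>If every monomial of weight \<open>w\<close> is congruent modulo \<open>J\<close> either to zero or to one and the same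
  monomial of its own degree, then the coefficients of the surviving monomials of weight \<open>w\<close> in the
  initial form add up to zero, because they are all the coefficients of \<open>f\<close> in weight \<open>w\<close>.\<close>

lemma initial_form_in_ideal:
  fixes G :: "'k::comm_ring_1 mpoly4 set"
  assumes N: "\<And>u. degree_compatible (ideal G) u (N u)"
    and N_weight: "\<And>u v. wt n u = wt n v \<Longrightarrow> N u = N v"
    and f: "f \<in> curve_ideal n"
  shows "initial_form f \<in> ideal G"
proof -
  define d where "d = (LEAST d. hom_component d f \<noteq> 0)"
  \<comment> \<open>\<open>T m\<close> is what survives of \<open>m\<close> in degree
    \<open>d\<close>. Like \<open>N m\<close>, it depends only on the weight of
    \<open>m\<close>.\<close>
  define T :: "expo \<Rightarrow> 'k mpoly4" where "T m = (if mdeg (N m) = d then mon (N m) else 0)" for m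
  let ?K = "Poly_Mapping.keys f"
  let ?c = "\<lambda>m. Poly_Mapping.single (0::expo) (Poly_Mapping.lookup f m)"
  let ?Kd = "{m \<in> ?K. mdeg m = d}"
  have "(\<Sum>m\<in>?Kd. ?c m * T m) = (\<Sum>m\<in>?K. ?c m * T m)"
  proof (rule sum.mono_neutral_left)
    have "T m = 0" if "m \<in> ?K - ?Kd" for m
    proof -
      have "d < mdeg m"
        using that hom_component_least[OF d_def] by force
      then show ?thesis
        using N[of m] by (auto simp: T_def degree_compatible_def)
    qed
    then show "\<forall>m\<in>?K - ?Kd. ?c m * T m = 0"
      by simp
  qed auto
  also have "\<dots> = 0"
  proof (rule curve_ideal_weighted_sum[OF f])
    fix u v
    assume "wt n u = wt n v"
    then have "N u = N v"
      by (rule N_weight)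
    then show "T u = T v"
      by (simp add: T_def)
  qed
  finally have zero: "(\<Sum>m\<in>?Kd. ?c m * T m) = 0" .
  have "initial_form f = hom_component d f"
    by (simp add: initial_form_def d_def)
  also have "\<dots> = (\<Sum>m\<in>?Kd. ?c m * mon m)"
    by (simp add: hom_component_def mult_single)
  also have "\<dots> = (\<Sum>m\<in>?Kd. ?c m * (mon m - T m))"
    using zero by (simp add: right_diff_distrib sum_subtractf)
  \<comment> \<open>If \<open>N m\<close> has degree \<open>d\<close>, then \<open>m\<close> and
    \<open>N m\<close> are congruent; if its degree is larger, then \<open>T m\<close> is zero and
    \<open>mon m\<close> itself lies in the ideal.\<close>
  also have "\<dots> \<in> ideal G"
  proof (intro ideal.span_sum ideal.span_scale)
    fix m
    assume "m \<in> ?Kd"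
    then show "mon m - T m \<in> ideal G"
      using N[of m] by (auto simp: T_def degree_compatible_def)
  qed
  finally show ?thesis .
qed

text \<open>Monomials of equal weight are connected, and confluence gives them the same normal form;
  this yields one inclusion. For the other, each element of \<open>G\<close> is the initial form of
  a binomial in the curve ideal.\<close>

lemma initial_ideal_eqI:
  fixes G :: "'k::comm_ring_1 mpoly4 set"
  assumes wf: "wf {(y, x). rstep R x y}" and confluent: "confluentp (rstep R)"
    and connected: "\<And>u v. wt n u = wt n v \<Longrightarrow> equivclp (rstep R) u v"
    and rules: "\<And>l r. (l, r) \<in> R \<Longrightarrow> degree_compatible (ideal G) l r"
    and generators: "\<And>g. g \<in> G \<Longrightarrow> \<exists>u v. wt n u = wt n v \<and> u \<noteq> v \<and> mdeg u \<le> mdeg v \<and>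
      g = (if mdeg u < mdeg v then mon u else mon u - mon v)"
  shows "initial_ideal (curve_ideal n) = ideal G"
proof
  have "\<forall>u. \<exists>z. (rstep R)\<^sup>*\<^sup>* u z \<and> (\<forall>w. \<not> rstep R z w)"
    using normal_form_exists[OF wf] by blast
  then obtain N where N: "\<And>u. (rstep R)\<^sup>*\<^sup>* u (N u)" and irreducible: "\<And>u w. \<not> rstep R (N u) w"
    by metis
  have N_weight: "N u = N v" if uv: "wt n u = wt n v" for u v
  proof -
    have "equivclp (rstep R) (N u) (N v)"
      by (meson N connected[OF uv] equivclp_sym equivclp_trans rtranclp_into_equivclp)
    then obtain w where "(rstep R)\<^sup>*\<^sup>* (N u) w" "(rstep R)\<^sup>*\<^sup>* (N v) w"
      using semiconfluentp_equivclp[OF confluentp_imp_semiconfluentp[OF confluent]]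
      by (auto simp: rtranclp_conversep)
    then show ?thesis
      using irreducible by (metis converse_rtranclpE)
  qed
  have "{initial_form f |f. f \<in> curve_ideal n \<and> f \<noteq> 0} \<subseteq> ideal G"
    using initial_form_in_ideal[OF degree_compatible_rsteps[OF rules N] N_weight] by blast
  then show "initial_ideal (curve_ideal n) \<subseteq> ideal G"
    unfolding initial_ideal_def by (rule ideal.span_minimal) simp
  have "G \<subseteq> {initial_form f |f. f \<in> curve_ideal n \<and> f \<noteq> 0}"
  proof
    fix g
    assume "g \<in> G"
    then obtain u v where uv: "wt n u = wt n v" "u \<noteq> v" "mdeg u \<le> mdeg v"
      and g: "g = (if mdeg u < mdeg v then mon u else mon u - mon v)"
      using generators by blast
    have "Poly_Mapping.lookup (mon u - mon v :: 'k mpoly4) u \<noteq> 0"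
      using uv(2) by (simp add: lookup_minus lookup_single)
    then have "(mon u - mon v :: 'k mpoly4) \<noteq> 0"
      by auto
    moreover have "(mon u - mon v :: 'k mpoly4) \<in> curve_ideal n"
      using uv(1) binomial_in_curve_ideal by blast
    moreover have "g = initial_form (mon u - mon v)"
      unfolding g by (rule initial_form_binomial[OF uv(2,3), symmetric])
    ultimately show "g \<in> {initial_form f |f. f \<in> curve_ideal n \<and> f \<noteq> 0}"
      by blast
  qed
  then show "ideal G \<subseteq> initial_ideal (curve_ideal n)"
    unfolding initial_ideal_def by (rule ideal.span_mono)
qed

section \<open>Minimality of a list of generators\<close>

definition isolated :: "expo \<Rightarrow> 'k::comm_ring_1 mpoly4 \<Rightarrow> 'k mpoly4 list \<Rightarrow> bool" where
  "isolated t g hs \<longleftrightarrow> t \<in> Poly_Mapping.keys g \<and>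
     (\<forall>h\<in>set hs. \<forall>m\<in>Poly_Mapping.keys h. \<nexists>u. t = m + u)"

text \<open>\<open>M\<close> may contain more than the terms that occur, so that one check serves
  all cases in the definitions of \<open>p2\<close>, \<open>p6\<close> and
  \<open>p7\<close>.\<close>

lemma isolatedI:
  assumes "t \<in> Poly_Mapping.keys g" "(\<Union>h\<in>set hs. Poly_Mapping.keys h) \<subseteq> M" "\<forall>m\<in>M. \<nexists>u. t = m + u"
  shows "isolated t g hs"
  unfolding isolated_def
proof (intro conjI ballI)
  fix h m
  assume "h \<in> set hs" "m \<in> Poly_Mapping.keys h"
  then have "m \<in> M"
    using assms(2) by blast
  then show "\<nexists>u. t = m + u"
    by (rule bspec[OF assms(3)])
qed (rule assms(1))

lemma isolated_not_in_ideal: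
  assumes "isolated t g hs"
  shows "g \<notin> ideal (set hs)"
proof
  assume "g \<in> ideal (set hs)"
  then have "Poly_Mapping.lookup g t = 0"
    by (rule coefficient_avoids_ideal[rotated]) (use assms in \<open>unfold isolated_def, blast\<close>)
  then show False
    using assms by (simp add: isolated_def in_keys_iff)
qed

text \<open>Deleting by position rather than by value also yields distinctness: an element standing
  at two positions would lie in the ideal of the remaining entries.\<close>

lemma minimally_generated_byI:
  assumes ideal: "ideal (set gs) = J"
    and isolated: "\<And>i. i < length gs \<Longrightarrow> \<exists>t. isolated t (gs ! i) (take i gs @ drop (Suc i) gs)"
  shows "minimally_generated_by J gs"
proof -
  have nth: "gs ! i \<notin> ideal (set (take i gs @ drop (Suc i) gs))" if "i < length gs" for i
    using isolated[OF that] isolated_not_in_ideal by blast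
  have others: "gs ! j \<in> set (take i gs @ drop (Suc i) gs)"
    if "i < length gs" "j < length gs" "i \<noteq> j" for i j
  proof (cases "j < i")
    case True
    then show ?thesis
      using that by (auto simp: in_set_conv_nth)
  next
    case False
    then have "drop (Suc i) gs ! (j - Suc i) = gs ! j" "j - Suc i < length (drop (Suc i) gs)"
      using that by auto
    then show ?thesis
      by (metis UnCI nth_mem set_append)
  qed
  have "distinct gs"
    unfolding distinct_conv_nth
  proof (intro allI impI notI)
    fix i j
    assume "i < length gs" "j < length gs" "i \<noteq> j" "gs ! i = gs ! j"
    then show False
      using nth[of i] ideal.span_base[OF others[of i j]] by simp
  qed
  moreover have "ideal (set gs - {g}) \<noteq> J" if "g \<in> set gs" for g
  proof
    assume J: "ideal (set gs - {g}) = J"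
    obtain i where i: "i < length gs" "g = gs ! i"
      using \<open>g \<in> set gs\<close> unfolding in_set_conv_nth by blast
    have "set gs - {g} \<subseteq> set (take i gs @ drop (Suc i) gs)"
    proof
      fix h
      assume "h \<in> set gs - {g}"
      then have "h \<in> set gs" and "h \<noteq> g"
        by simp_all
      then obtain j where j: "j < length gs" "h = gs ! j"
        unfolding in_set_conv_nth by blast
      then have "i \<noteq> j"
        using i \<open>h \<noteq> g\<close> by blast
      then show "h \<in> set (take i gs @ drop (Suc i) gs)"
        unfolding j(2) by (rule others[OF i(1) j(1)])
    qed
    then have "ideal (set gs - {g}) \<subseteq> ideal (set (take i gs @ drop (Suc i) gs))"
      by (rule ideal.span_mono)
    moreover have "g \<in> ideal (set gs - {g})"
      unfolding J ideal[symmetric] using that by (rule ideal.span_base)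
    ultimately show False
      using nth[OF i(1)] unfolding i(2) by blast
  qed
  ultimately show ?thesis
    using ideal by (simp add: minimally_generated_by_def)
qed

section \<open>The standard basis as a rewriting system\<close>

locale gorenstein_rules =
  bresinsky_generators a1 a2 a3 a4 a13 a14 a21 a23 a32 a34 a41 a42 n
  for a1 a2 a3 a4 a13 a14 a21 a23 a32 a34 a41 a42 n +
  assumes n_less: "n I1 < n I2" "n I2 < n I3" "n I3 < n I4"
    and case_5: "a21 + a34 < a42 + a13"
    and case_14: "a14 \<le> a34"
    and cond_2: "a2 \<le> a21 + a23"
    and cond_3: "a32 + a34 \<le> a3"
    and cond_6: "a3 + a13 \<le> a1 + a32 + a34 - a14"
begin

text \<open>Rules 1 to 5 are the binomials \<open>f\<^sub>1, \<dots>, f\<^sub>5\<close>, oriented so that the degree does not drop.  Rule 6 closes the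
  critical pair of rules 1 and 3, rule 7 that of rules 1 and 5.\<close>

abbreviation "l1 \<equiv> expo4 0 0 a13 a14"  abbreviation "r1 \<equiv> expo4 a1 0 0 0"
abbreviation "l2 \<equiv> expo4 0 a2 0 0"  abbreviation "r2 \<equiv> expo4 a21 0 a23 0"
abbreviation "l3 \<equiv> expo4 0 a32 0 a34"  abbreviation "r3 \<equiv> expo4 0 0 a3 0"
abbreviation "l4 \<equiv> expo4 0 0 0 a4"  abbreviation "r4 \<equiv> expo4 a41 a42 0 0"
abbreviation "l5 \<equiv> expo4 a21 0 0 a34"  abbreviation "r5 \<equiv> expo4 0 a42 a13 0"
abbreviation "l6 \<equiv> expo4 0 0 (a3 + a13) 0"  abbreviation "r6 \<equiv> expo4 a1 a32 0 (a34 - a14)"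
abbreviation "l7 \<equiv> expo4 0 a42 (2 * a13) 0"  abbreviation "r7 \<equiv> expo4 (a1 + a21) 0 0 (a34 - a14)"

definition rules :: "(expo \<times> expo) set" where
  "rules = {(l1, r1), (l2, r2), (l3, r3), (l4, r4), (l5, r5), (l6, r6), (l7, r7)}"

lemma in_rules:
  "(l1, r1) \<in> rules" "(l2, r2) \<in> rules" "(l3, r3) \<in> rules" "(l4, r4) \<in> rules"
  "(l5, r5) \<in> rules" "(l6, r6) \<in> rules" "(l7, r7) \<in> rules"
  by (simp_all add: rules_def)

text \<open>Hence the case \<open>a\<^sub>3\<^sub>2 + a\<^sub>3\<^sub>4 = a\<^sub>3\<close> in the definition of \<open>p\<^sub>3\<close> never occurs; there \<open>p\<^sub>6\<close> would be a
  redundant generator.\<close>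

lemma cond_3_strict: "a32 + a34 < a3"
  using case_5 cond_2 cond_3 exponent_relations by linarith

text \<open>\<open>x1\<close> is the lightest variable, so a monomial in heavier variables with the
  weight of \<open>x1^a1\<close> has smaller degree. In \<open>degree_4\<close> the same argument
  uses that \<open>x4\<close> is the heaviest.\<close>

lemma degree_1: "a13 + a14 < a1"
proof -
  have "(a13 + a14) * n I1 < a13 * n I3 + a14 * n I4"
    using pos(1,2) n_less by (simp add: distrib_right add_strict_mono)
  then show ?thesis
    using weights(1) n_pos(1) by (metis mult_less_cancel2)
qed

lemma degree_4: "a4 < a41 + a42"
proof -
  have "a41 * n I1 + a42 * n I2 < (a41 + a42) * n I4"
    using pos(7,8) n_less by (simp add: distrib_right add_strict_mono)
  then show ?thesis
    using weights(4) n_pos by (metis mult_less_cancel2)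
qed

text \<open>This is the sum of \<open>cond_2\<close> and \<open>cond_6\<close> after cancelling
  \<open>a23 + a32\<close>. Hence equality holds exactly if it holds in both, which explains the
  case distinction for \<open>p7\<close>.\<close>

lemma degree_7: "a42 + 2 * a13 \<le> a1 + a21 + (a34 - a14)"
  using cond_2 cond_6 case_14 exponent_relations by linarith

lemma degree_7_eq_iff:
  "a42 + 2 * a13 = a1 + a21 + (a34 - a14) \<longleftrightarrow>
     a2 = a21 + a23 \<and> a3 + a13 = a1 + a32 + a34 - a14"
  using cond_2 cond_6 case_14 exponent_relations by linarith

lemma rules_weight:
  assumes "(l, r) \<in> rules"
  shows "wt n l = wt n r"
proof -
  have e34: "a34 * n I4 = a14 * n I4 + (a34 - a14) * n I4"
    using case_14 by (simp flip: distrib_right)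
  show ?thesis
    using assms weights e34
    by (auto simp: rules_def wt_expo4 distrib_right)
qed

text \<open>Only rules 2, 6 and 7 can keep the degree, and in these \<open>x1\<close> occurs on the
  right but not on the left.\<close>

lemma rules_degree:
  assumes "(l, r) \<in> rules"
  shows "mdeg l < mdeg r \<or> mdeg l = mdeg r \<and> Poly_Mapping.lookup l I1 < Poly_Mapping.lookup r I1"
  using assms cond_3_strict degree_1 degree_4 degree_7 case_5 case_14 cond_2 cond_6 pos
  by (auto simp: rules_def)

lemma rstep_weight: "rstep rules x y \<Longrightarrow> wt n x = wt n y"
  by (auto simp: rstep_def wt_add rules_weight)

text \<open>The weight is invariant and bounds both the degree and the exponent of \<open>x\<^sub>1\<close>; every step increases
  the degree, or keeps it and increases the exponent of \<open>x\<^sub>1\<close>.\<close>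

lemma rules_terminating: "wf {(y, x). rstep rules x y}"
proof (rule wf_subset[OF wf_measures])
  let ?m = "measures [\<lambda>x. wt n x - mdeg x, \<lambda>x. wt n x - Poly_Mapping.lookup x I1]"
  have m: "mdeg x \<le> wt n x" "Poly_Mapping.lookup x I1 \<le> mdeg x" for x
    using n_pos by (auto simp: mdeg_def wt_def sum_idx intro!: add_mono)
  show "{(y, x). rstep rules x y} \<subseteq> ?m"
  proof clarify
    fix x y
    assume s: "rstep rules x y"
    then obtain l r u where lr: "(l, r) \<in> rules" "x = l + u" "y = r + u"
      unfolding rstep_def by blast
    have "mdeg x < mdeg y \<or> mdeg x = mdeg y \<and> Poly_Mapping.lookup x I1 < Poly_Mapping.lookup y I1"
      using rules_degree[OF lr(1)] by (auto simp: lr(2,3) mdeg_add lookup_add)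
    then show "(y, x) \<in> ?m"
      using rstep_weight[OF s] m[of x] m[of y] by auto
  qed
qed

text \<open>Of the 21 pairs nine have coprime left-hand sides. For the other twelve the cofactors
  given to \<open>confluent_peakI\<close> lift both left-hand sides to their least common multiple;
  ten pairs close with a single further step, the pairs 3, 4 and 3, 7 with one step on each
  side.\<close>

lemma confluent_peaks:
  "confluent_peak rules (l1, r1) (l2, r2)" "confluent_peak rules (l1, r1) (l3, r3)"
  "confluent_peak rules (l1, r1) (l4, r4)" "confluent_peak rules (l1, r1) (l5, r5)"
  "confluent_peak rules (l1, r1) (l6, r6)" "confluent_peak rules (l1, r1) (l7, r7)"
  "confluent_peak rules (l2, r2) (l3, r3)" "confluent_peak rules (l2, r2) (l4, r4)"
  "confluent_peak rules (l2, r2) (l5, r5)" "confluent_peak rules (l2, r2) (l6, r6)"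
  "confluent_peak rules (l2, r2) (l7, r7)" "confluent_peak rules (l3, r3) (l4, r4)"
  "confluent_peak rules (l3, r3) (l5, r5)" "confluent_peak rules (l3, r3) (l6, r6)"
  "confluent_peak rules (l3, r3) (l7, r7)" "confluent_peak rules (l4, r4) (l5, r5)"
  "confluent_peak rules (l4, r4) (l6, r6)" "confluent_peak rules (l4, r4) (l7, r7)"
  "confluent_peak rules (l5, r5) (l6, r6)" "confluent_peak rules (l5, r5) (l7, r7)"
  "confluent_peak rules (l6, r6) (l7, r7)"
proof -
  note facts = exponent_relations case_14
  show "confluent_peak rules (l1, r1) (l2, r2)" "confluent_peak rules (l2, r2) (l4, r4)"
    "confluent_peak rules (l2, r2) (l5, r5)" "confluent_peak rules (l2, r2) (l6, r6)"
    "confluent_peak rules (l3, r3) (l6, r6)" "confluent_peak rules (l4, r4) (l6, r6)"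
    "confluent_peak rules (l4, r4) (l7, r7)" "confluent_peak rules (l5, r5) (l6, r6)"
    "confluent_peak rules (l5, r5) (l7, r7)"
    by (rule coprime_confluent_peak[OF in_rules(1,2)] coprime_confluent_peak[OF in_rules(2,4)]
        coprime_confluent_peak[OF in_rules(2,5)] coprime_confluent_peak[OF in_rules(2,6)]
        coprime_confluent_peak[OF in_rules(3,6)] coprime_confluent_peak[OF in_rules(4,6)]
        coprime_confluent_peak[OF in_rules(4,7)] coprime_confluent_peak[OF in_rules(5,6)]
        coprime_confluent_peak[OF in_rules(5,7)], simp)+
  show "confluent_peak rules (l1, r1) (l3, r3)"
  proof (rule confluent_peakI[of _ "expo4 0 a32 0 (a34 - a14)" _ "expo4 0 0 a13 0"])
    show "joinable (rstep rules) (r1 + expo4 0 a32 0 (a34 - a14)) (r3 + expo4 0 0 a13 0)"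
      unfolding expo4_add by (rule joinable_right, rule rstep_expo4I[OF in_rules(6)]) (use facts in auto)
  qed (use facts in \<open>auto simp: expo4_add\<close>)
  show "confluent_peak rules (l1, r1) (l4, r4)"
  proof (rule confluent_peakI[of _ "expo4 0 0 0 a34" _ "expo4 0 0 a13 0"])
    show "joinable (rstep rules) (r1 + expo4 0 0 0 a34) (r4 + expo4 0 0 a13 0)"
      unfolding expo4_add by (rule joinable_left, rule rstep_expo4I[OF in_rules(5)]) (use facts in auto)
  qed (use facts in \<open>auto simp: expo4_add\<close>)
  show "confluent_peak rules (l1, r1) (l5, r5)"
  proof (rule confluent_peakI[of _ "expo4 a21 0 0 (a34 - a14)" _ "expo4 0 0 a13 0"])
    show "joinable (rstep rules) (r1 + expo4 a21 0 0 (a34 - a14)) (r5 + expo4 0 0 a13 0)"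
      unfolding expo4_add by (rule joinable_right, rule rstep_expo4I[OF in_rules(7)]) (use facts in auto)
  qed (use facts in \<open>auto simp: expo4_add\<close>)
  show "confluent_peak rules (l1, r1) (l6, r6)"
  proof (rule confluent_peakI[of _ "expo4 0 0 a3 0" _ "expo4 0 0 0 a14"])
    show "joinable (rstep rules) (r1 + expo4 0 0 a3 0) (r6 + expo4 0 0 0 a14)"
      unfolding expo4_add by (rule joinable_right, rule rstep_expo4I[OF in_rules(3)]) (use facts in auto)
  qed (use facts in \<open>auto simp: expo4_add\<close>)
  show "confluent_peak rules (l1, r1) (l7, r7)"
  proof (rule confluent_peakI[of _ "expo4 0 a42 a13 0" _ "expo4 0 0 0 a14"])
    show "joinable (rstep rules) (r1 + expo4 0 a42 a13 0) (r7 + expo4 0 0 0 a14)"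
      unfolding expo4_add by (rule joinable_right, rule rstep_expo4I[OF in_rules(5)]) (use facts in auto)
  qed (use facts in \<open>auto simp: expo4_add\<close>)
  show "confluent_peak rules (l2, r2) (l3, r3)"
  proof (rule confluent_peakI[of _ "expo4 0 0 0 a34" _ "expo4 0 a42 0 0"])
    show "joinable (rstep rules) (r2 + expo4 0 0 0 a34) (r3 + expo4 0 a42 0 0)"
      unfolding expo4_add by (rule joinable_left, rule rstep_expo4I[OF in_rules(5)]) (use facts in auto)
  qed (use facts in \<open>auto simp: expo4_add\<close>)
  show "confluent_peak rules (l2, r2) (l7, r7)"
  proof (rule confluent_peakI[of _ "expo4 0 0 (2 * a13) 0" _ "expo4 0 a32 0 0"])
    show "joinable (rstep rules) (r2 + expo4 0 0 (2 * a13) 0) (r7 + expo4 0 a32 0 0)"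
      unfolding expo4_add by (rule joinable_left, rule rstep_expo4I[OF in_rules(6)]) (use facts in auto)
  qed (use facts in \<open>auto simp: expo4_add\<close>)
  show "confluent_peak rules (l3, r3) (l4, r4)"
  proof (rule confluent_peakI[of _ "expo4 0 0 0 a14" _ "expo4 0 a32 0 0"])
    \<comment> \<open>Both sides reach \<open>x1^a1 x3^a23\<close>: one by
      \<open>a3 = a13 + a23\<close>, the other by \<open>a1 = a21 + a41\<close> and
      \<open>a2 = a32 + a42\<close>.\<close>
    have "rstep rules (r3 + expo4 0 0 0 a14) (expo4 a1 0 a23 0)"
      unfolding expo4_add by (rule rstep_expo4I[OF in_rules(1)]) (use facts in auto)
    moreover have "rstep rules (r4 + expo4 0 a32 0 0) (expo4 a1 0 a23 0)"
      unfolding expo4_add by (rule rstep_expo4I[OF in_rules(2)]) (use facts in auto)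
    ultimately show "joinable (rstep rules) (r3 + expo4 0 0 0 a14) (r4 + expo4 0 a32 0 0)"
      by (rule joinable_both)
  qed (use facts in \<open>auto simp: expo4_add\<close>)
  show "confluent_peak rules (l3, r3) (l5, r5)"
  proof (rule confluent_peakI[of _ "expo4 a21 0 0 0" _ "expo4 0 a32 0 0"])
    show "joinable (rstep rules) (r3 + expo4 a21 0 0 0) (r5 + expo4 0 a32 0 0)"
      unfolding expo4_add by (rule joinable_right, rule rstep_expo4I[OF in_rules(2)]) (use facts in auto)
  qed (use facts in \<open>auto simp: expo4_add\<close>)
  show "confluent_peak rules (l3, r3) (l7, r7)"
  \<comment> \<open>The order of \<open>a32\<close> and \<open>a42\<close> is not known. With
    truncated subtraction \<open>a32 + (a42 - a32)\<close> is their maximum, so both cases are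
    handled at once.\<close>
  proof (rule confluent_peakI[of _ "expo4 0 (a42 - a32) (2 * a13) 0" _ "expo4 0 (a32 - a42) 0 a34"])
    have "rstep rules (r3 + expo4 0 (a42 - a32) (2 * a13) 0) (expo4 a1 (a32 + (a42 - a32)) a13 (a34 - a14))"
      unfolding expo4_add by (rule rstep_expo4I[OF in_rules(6)]) (use facts in auto)
    moreover have "rstep rules (r7 + expo4 0 (a32 - a42) 0 a34) (expo4 a1 (a32 + (a42 - a32)) a13 (a34 - a14))"
      unfolding expo4_add by (rule rstep_expo4I[OF in_rules(5)]) (use facts in auto)
    ultimately show "joinable (rstep rules) (r3 + expo4 0 (a42 - a32) (2 * a13) 0) (r7 + expo4 0 (a32 - a42) 0 a34)"
      by (rule joinable_both)
  qed (use facts in \<open>auto simp: expo4_add\<close>)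
  show "confluent_peak rules (l4, r4) (l5, r5)"
  proof (rule confluent_peakI[of _ "expo4 a21 0 0 0" _ "expo4 0 0 0 a14"])
    show "joinable (rstep rules) (r4 + expo4 a21 0 0 0) (r5 + expo4 0 0 0 a14)"
      unfolding expo4_add by (rule joinable_right, rule rstep_expo4I[OF in_rules(1)]) (use facts in auto)
  qed (use facts in \<open>auto simp: expo4_add\<close>)
  show "confluent_peak rules (l6, r6) (l7, r7)"
  proof (rule confluent_peakI[of _ "expo4 0 a42 0 0" _ "expo4 0 0 a23 0"])
    show "joinable (rstep rules) (r6 + expo4 0 a42 0 0) (r7 + expo4 0 0 a23 0)"
      unfolding expo4_add by (rule joinable_left, rule rstep_expo4I[OF in_rules(2)]) (use facts in auto)
  qed (use facts in \<open>auto simp: expo4_add\<close>)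
qed

lemma rules_confluent: "confluentp (rstep rules)"
proof (rule newman[OF rules_terminating], rule rstep_locally_confluent)
  fix p q
  assume "p \<in> rules" "q \<in> rules"
  from this[unfolded rules_def] show "confluent_peak rules p q"
    by (elim insertE emptyE;
        simp only: confluent_peak_refl confluent_peaks confluent_peaks[THEN confluent_peak_sym])
qed

text \<open>Each of the five binomials is a rule in one of the two orientations; \<open>f1\<close>
  and \<open>f3\<close> occur reversed.\<close>

lemma rules_connected:
  assumes "wt n u = wt n v"
  shows "equivclp (rstep rules) u v"
proof (rule equivclp_rstep_mono[OF _ connected[OF assms]])
  fix l r
  note equiv = in_rules[THEN rstep_rule, THEN r_into_equivclp[where r = "rstep rules"]]
  assume "(l, r) \<in> binomials"
  then show "equivclp (rstep rules) l r"
    unfolding binomials_def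
    by (elim insertE emptyE; simp only: prod.inject equiv equiv[THEN equivclp_sym])
qed

section \<open>The seven forms generate the initial ideal minimally\<close>

lemma initial_ideal_minimal_generators:
  fixes p2 p3 p6 p7 :: "'k::comm_ring_1 mpoly4"
  assumes p2: "p2 = (if a2 < a21 + a23 then mon l2 else mon l2 - mon r2)"
    and p3: "p3 = (if a32 + a34 < a3 then mon l3 else mon r3 - mon l3)"
    and p6: "p6 = (if a3 + a13 < a1 + a32 + a34 - a14 then mon l6 else mon l6 - mon r6)"
    and p7: "p7 = (if a2 = a21 + a23 \<and> a3 + a13 = a1 + a32 + a34 - a14 then mon r7 - mon l7
      else mon l7)"
  shows "minimally_generated_by (initial_ideal (curve_ideal n))
    [mon l1, p2, p3, mon l4, mon l5, p6, p7]"
proof -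
  have "minimally_generated_by (initial_ideal (curve_ideal n))
      [mon l1, p2, mon l3, mon l4, mon l5, p6, p7]"
  proof (rule minimally_generated_byI)
    let ?G = "[mon l1, p2, mon l3, mon l4, mon l5, p6, p7]"
    have degree_6: "mdeg l6 < mdeg r6 \<longleftrightarrow> a3 + a13 < a1 + a32 + a34 - a14"
      "mdeg l6 \<le> mdeg r6"
      using cond_6 case_14 by auto
    have degree_7: "mdeg l7 < mdeg r7 \<longleftrightarrow> \<not> (a2 = a21 + a23 \<and> a3 + a13 = a1 + a32 + a34 - a14)"
      "mdeg l7 \<le> mdeg r7"
      unfolding degree_7_eq_iff[symmetric] using degree_7 by auto
    have p2': "p2 = (if mdeg l2 < mdeg r2 then mon l2 else mon l2 - mon r2)"
      by (simp add: p2)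
    have p6': "p6 = (if mdeg l6 < mdeg r6 then mon l6 else mon l6 - mon r6)"
      unfolding degree_6(1) by (rule p6)
    \<comment> \<open>In the case of equality \<open>p7\<close> is the negative of the initial form
      of \<open>mon l7 - mon r7\<close>; hence \<open>ideal.span_neg\<close> and the alternative
      \<open>?initial r7 l7\<close> below.\<close>
    have p7': "p7 = (if mdeg l7 < mdeg r7 then mon l7 else mon r7 - mon l7)"
      unfolding degree_7(1) using p7 by simp
    have base: "g \<in> ideal (set ?G)" if "g \<in> set ?G" for g :: "'k mpoly4"
      using that by (rule ideal.span_base)
    show "ideal (set ?G) = initial_ideal (curve_ideal n)"
    proof (rule initial_ideal_eqI[OF rules_terminating rules_confluent rules_connected, symmetric])
      fix l r
      assume "(l, r) \<in> rules"
      moreover have "degree_compatible (ideal (set ?G)) l1 r1"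
        using degree_1 base[of "mon l1"] by (simp add: degree_compatible_def)
      moreover have "degree_compatible (ideal (set ?G)) l2 r2"
        using cond_2 base[of p2] p2' by (auto simp: degree_compatible_def split: if_splits)
      moreover have "degree_compatible (ideal (set ?G)) l3 r3"
        using cond_3_strict base[of "mon l3"] by (simp add: degree_compatible_def)
      moreover have "degree_compatible (ideal (set ?G)) l4 r4"
        using degree_4 base[of "mon l4"] by (simp add: degree_compatible_def)
      moreover have "degree_compatible (ideal (set ?G)) l5 r5"
        using case_5 base[of "mon l5"] by (simp add: degree_compatible_def)
      moreover have "degree_compatible (ideal (set ?G)) l6 r6"
        using degree_6(2) base[of p6] p6' unfolding degree_compatible_def
        by (cases "mdeg l6 < mdeg r6") (simp_all del: mdeg_expo4)
      moreover have "degree_compatible (ideal (set ?G)) l7 r7"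
        using degree_7(2) base[of p7] ideal.span_neg[OF base[of p7]] p7' unfolding degree_compatible_def
        by (cases "mdeg l7 < mdeg r7") (simp_all del: mdeg_expo4)
      ultimately show "degree_compatible (ideal (set ?G)) l r"
        unfolding rules_def by blast
    next
      fix g :: "'k mpoly4"
      let ?initial = "\<lambda>u v. wt n u = wt n v \<and> u \<noteq> v \<and> mdeg u \<le> mdeg v \<and>
        g = (if mdeg u < mdeg v then mon u else mon u - mon v)"
      note w = in_rules[THEN rules_weight]
      assume "g \<in> set ?G"
      moreover have "?initial l1 r1" if "g = mon l1"
        using that w(1) degree_1 pos by simp
      moreover have "?initial l2 r2" if "g = p2"
        using that w(2) cond_2 pos p2' by simp
      moreover have "?initial l3 r3" if "g = mon l3"
        using that w(3) cond_3_strict pos by simp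
      moreover have "?initial l4 r4" if "g = mon l4"
        using that w(4) degree_4 pos by simp
      moreover have "?initial l5 r5" if "g = mon l5"
        using that w(5) case_5 pos by simp
      moreover have "?initial l6 r6" if "g = p6"
        using that w(6) degree_6(2) pos p6' by (simp del: mdeg_expo4)
      moreover have "?initial l7 r7 \<or> ?initial r7 l7" if "g = p7"
        using that w(7) degree_7(2) pos p7' by (auto simp del: mdeg_expo4)
      ultimately show "\<exists>u v. ?initial u v"
        unfolding set_simps by blast
    qed
  next
    fix i
    let ?G = "[mon l1, p2, mon l3, mon l4, mon l5, p6, p7]"
    have ne: "l2 \<noteq> r2" "l6 \<noteq> r6" "l7 \<noteq> r7"
      using pos by simp_all
    have own: "l2 \<in> Poly_Mapping.keys p2" "l6 \<in> Poly_Mapping.keys p6" "l7 \<in> Poly_Mapping.keys p7"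
      using ne by (simp_all add: p2 p6 p7 in_keys_iff lookup_minus lookup_single del: expo4_eq_iff)
    have keys: "Poly_Mapping.keys p2 \<subseteq> {l2, r2}" "Poly_Mapping.keys p6 \<subseteq> {l6, r6}"
      "Poly_Mapping.keys p7 \<subseteq> {l7, r7}"
      using keys_diff[of "mon l2 :: 'k mpoly4" "mon r2"] keys_diff[of "mon l6 :: 'k mpoly4" "mon r6"]
        keys_diff[of "mon r7 :: 'k mpoly4" "mon l7"]
      by (auto simp: p2 p6 p7)
    have mon: "Poly_Mapping.keys (mon m :: 'k mpoly4) = {m}" for m
      by simp
    note supports = list.set UN_insert UN_empty mon Un_subset_iff
    have bounds: "0 < a1" "0 < a2" "0 < a3" "0 < a4" "\<not> a2 \<le> a42" "\<not> a2 \<le> a32" "\<not> a3 \<le> a13" "\<not> a4 \<le> a14" "\<not> a4 \<le> a34" "\<not> a1 \<le> a21"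
      using pos exponent_relations by simp_all
    note divides = expo4_not_divides pos bounds
    \<comment> \<open>The left-hand side of each rule is the isolated term of its form. All terms
      that the other forms can have in any case are listed, so no case distinction is
      needed.\<close>
    have 1: "\<forall>m\<in>{l2, r2, l3, l4, l5, l6, r6, l7, r7}. \<nexists>u. l1 = m + u"
      by (simp add: divides)
    have 2: "\<forall>m\<in>{l1, l3, l4, l5, l6, r6, l7, r7}. \<nexists>u. l2 = m + u"
      by (simp add: divides)
    have 3: "\<forall>m\<in>{l1, l2, r2, l4, l5, l6, r6, l7, r7}. \<nexists>u. l3 = m + u"
      by (simp add: divides)
    have 4: "\<forall>m\<in>{l1, l2, r2, l3, l5, l6, r6, l7, r7}. \<nexists>u. l4 = m + u"
      by (simp add: divides)
    have 5: "\<forall>m\<in>{l1, l2, r2, l3, l4, l6, r6, l7, r7}. \<nexists>u. l5 = m + u"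
      by (simp add: divides)
    have 6: "\<forall>m\<in>{l1, l2, r2, l3, l4, l5, l7, r7}. \<nexists>u. l6 = m + u"
      by (simp add: divides)
    have 7: "\<forall>m\<in>{l1, l2, r2, l3, l4, l5, l6, r6}. \<nexists>u. l7 = m + u"
      by (simp add: divides)
    have "isolated l1 (mon l1) [p2, mon l3, mon l4, mon l5, p6, p7]"
      by (rule isolatedI[OF _ _ 1], use own in simp, unfold supports, use keys in blast)
    moreover have "isolated l2 p2 [mon l1, mon l3, mon l4, mon l5, p6, p7]"
      by (rule isolatedI[OF _ _ 2], use own in simp, unfold supports, use keys in blast)
    moreover have "isolated l3 (mon l3) [mon l1, p2, mon l4, mon l5, p6, p7]"
      by (rule isolatedI[OF _ _ 3], use own in simp, unfold supports, use keys in blast)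
    moreover have "isolated l4 (mon l4) [mon l1, p2, mon l3, mon l5, p6, p7]"
      by (rule isolatedI[OF _ _ 4], use own in simp, unfold supports, use keys in blast)
    moreover have "isolated l5 (mon l5) [mon l1, p2, mon l3, mon l4, p6, p7]"
      by (rule isolatedI[OF _ _ 5], use own in simp, unfold supports, use keys in blast)
    moreover have "isolated l6 p6 [mon l1, p2, mon l3, mon l4, mon l5, p7]"
      by (rule isolatedI[OF _ _ 6], use own in simp, unfold supports, use keys in blast)
    moreover have "isolated l7 p7 [mon l1, p2, mon l3, mon l4, mon l5, p6]"
      by (rule isolatedI[OF _ _ 7], use own in simp, unfold supports, use keys in blast)
    moreover assume "i < length ?G"
    then have "i = 0 \<or> i = 1 \<or> i = 2 \<or> i = 3 \<or> i = 4 \<or> i = 5 \<or> i = 6"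
      by (simp, linarith)
    ultimately show "\<exists>t. isolated t (?G ! i) (take i ?G @ drop (Suc i) ?G)"
      by (elim disjE; hypsubst; auto)
  qed
  moreover have "p3 = mon l3"
    using cond_3_strict by (simp add: p3)
  ultimately show ?thesis
    by simp
qed

end

section \<open>Reduction of the theorem to exponent vectors\<close>

theorem theorem3p2:
  fixes n :: "idx \<Rightarrow> nat"
    and a\<^sub>1 a\<^sub>2 a\<^sub>3 a\<^sub>4 a\<^sub>1\<^sub>3 a\<^sub>1\<^sub>4 a\<^sub>2\<^sub>1 a\<^sub>2\<^sub>3 a\<^sub>3\<^sub>2 a\<^sub>3\<^sub>4 a\<^sub>4\<^sub>1 a\<^sub>4\<^sub>2 :: nat
    and f\<^sub>1 f\<^sub>2 f\<^sub>3 f\<^sub>4 f\<^sub>5 p\<^sub>2 p\<^sub>3 p\<^sub>6 p\<^sub>7 :: "'k::field mpoly4"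
  assumes n_pos: "0 < n I1"
    and n_less: "n I1 < n I2" "n I2 < n I3" "n I3 < n I4"
    and n_gcd: "Gcd {n I1, n I2, n I3, n I4} = 1"
    and gorenstein: "gorenstein_curve n"
    and not_ci: "\<not> complete_intersection (curve_ideal n :: 'k mpoly4 set)"
    and f1: "f\<^sub>1 = x\<^sub>1 ^ a\<^sub>1 - x\<^sub>3 ^ a\<^sub>1\<^sub>3 * x\<^sub>4 ^ a\<^sub>1\<^sub>4"
    and f2: "f\<^sub>2 = x\<^sub>2 ^ a\<^sub>2 - x\<^sub>1 ^ a\<^sub>2\<^sub>1 * x\<^sub>3 ^ a\<^sub>2\<^sub>3"
    and f3: "f\<^sub>3 = x\<^sub>3 ^ a\<^sub>3 - x\<^sub>2 ^ a\<^sub>3\<^sub>2 * x\<^sub>4 ^ a\<^sub>3\<^sub>4"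
    and f4: "f\<^sub>4 = x\<^sub>4 ^ a\<^sub>4 - x\<^sub>1 ^ a\<^sub>4\<^sub>1 * x\<^sub>2 ^ a\<^sub>4\<^sub>2"
    and f5: "f\<^sub>5 = x\<^sub>1 ^ a\<^sub>2\<^sub>1 * x\<^sub>4 ^ a\<^sub>3\<^sub>4 - x\<^sub>2 ^ a\<^sub>4\<^sub>2 * x\<^sub>3 ^ a\<^sub>1\<^sub>3"
    and f_gens: "minimally_generated_by (curve_ideal n) [f\<^sub>1, f\<^sub>2, f\<^sub>3, f\<^sub>4, f\<^sub>5]"
    and a_gt_1: "1 < a\<^sub>1" "1 < a\<^sub>2" "1 < a\<^sub>3" "1 < a\<^sub>4"
    and a13: "0 < a\<^sub>1\<^sub>3" "a\<^sub>1\<^sub>3 < a\<^sub>3"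
    and a14: "0 < a\<^sub>1\<^sub>4" "a\<^sub>1\<^sub>4 < a\<^sub>4"
    and a21: "0 < a\<^sub>2\<^sub>1" "a\<^sub>2\<^sub>1 < a\<^sub>1"
    and a23: "0 < a\<^sub>2\<^sub>3" "a\<^sub>2\<^sub>3 < a\<^sub>3"
    and a32: "0 < a\<^sub>3\<^sub>2" "a\<^sub>3\<^sub>2 < a\<^sub>2"
    and a34: "0 < a\<^sub>3\<^sub>4" "a\<^sub>3\<^sub>4 < a\<^sub>4"
    and a41: "0 < a\<^sub>4\<^sub>1" "a\<^sub>4\<^sub>1 < a\<^sub>1"
    and a42: "0 < a\<^sub>4\<^sub>2" "a\<^sub>4\<^sub>2 < a\<^sub>2"
    and case_5: "a\<^sub>2\<^sub>1 + a\<^sub>3\<^sub>4 < a\<^sub>4\<^sub>2 + a\<^sub>1\<^sub>3"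
    and case_14: "a\<^sub>1\<^sub>4 \<le> a\<^sub>3\<^sub>4"
    and cond_2: "a\<^sub>2 \<le> a\<^sub>2\<^sub>1 + a\<^sub>2\<^sub>3"
    and cond_3: "a\<^sub>3\<^sub>2 + a\<^sub>3\<^sub>4 \<le> a\<^sub>3"
    and cond_6: "a\<^sub>3 + a\<^sub>1\<^sub>3 \<le> a\<^sub>1 + a\<^sub>3\<^sub>2 + a\<^sub>3\<^sub>4 - a\<^sub>1\<^sub>4"
    and p2: "p\<^sub>2 = (if a\<^sub>2 < a\<^sub>2\<^sub>1 + a\<^sub>2\<^sub>3 then x\<^sub>2 ^ a\<^sub>2
                  else x\<^sub>2 ^ a\<^sub>2 - x\<^sub>1 ^ a\<^sub>2\<^sub>1 * x\<^sub>3 ^ a\<^sub>2\<^sub>3)"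
    and p3: "p\<^sub>3 = (if a\<^sub>3\<^sub>2 + a\<^sub>3\<^sub>4 < a\<^sub>3 then x\<^sub>2 ^ a\<^sub>3\<^sub>2 * x\<^sub>4 ^ a\<^sub>3\<^sub>4
                  else x\<^sub>3 ^ a\<^sub>3 - x\<^sub>2 ^ a\<^sub>3\<^sub>2 * x\<^sub>4 ^ a\<^sub>3\<^sub>4)"
    and p6: "p\<^sub>6 = (if a\<^sub>3 + a\<^sub>1\<^sub>3 < a\<^sub>1 + a\<^sub>3\<^sub>2 + a\<^sub>3\<^sub>4 - a\<^sub>1\<^sub>4 then x\<^sub>3 ^ (a\<^sub>3 + a\<^sub>1\<^sub>3)
                  else x\<^sub>3 ^ (a\<^sub>3 + a\<^sub>1\<^sub>3) - x\<^sub>1 ^ a\<^sub>1 * x\<^sub>2 ^ a\<^sub>3\<^sub>2 * x\<^sub>4 ^ (a\<^sub>3\<^sub>4 - a\<^sub>1\<^sub>4))"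
    and p7: "p\<^sub>7 = (if a\<^sub>2 = a\<^sub>2\<^sub>1 + a\<^sub>2\<^sub>3 \<and> a\<^sub>3 + a\<^sub>1\<^sub>3 = a\<^sub>1 + a\<^sub>3\<^sub>2 + a\<^sub>3\<^sub>4 - a\<^sub>1\<^sub>4
                  then x\<^sub>1 ^ (a\<^sub>1 + a\<^sub>2\<^sub>1) * x\<^sub>4 ^ (a\<^sub>3\<^sub>4 - a\<^sub>1\<^sub>4) - x\<^sub>2 ^ a\<^sub>4\<^sub>2 * x\<^sub>3 ^ (2 * a\<^sub>1\<^sub>3)
                  else x\<^sub>2 ^ a\<^sub>4\<^sub>2 * x\<^sub>3 ^ (2 * a\<^sub>1\<^sub>3))"
  shows "minimally_generated_by (initial_ideal (curve_ideal n))
           [x\<^sub>3 ^ a\<^sub>1\<^sub>3 * x\<^sub>4 ^ a\<^sub>1\<^sub>4, p\<^sub>2, p\<^sub>3, x\<^sub>4 ^ a\<^sub>4, x\<^sub>1 ^ a\<^sub>2\<^sub>1 * x\<^sub>4 ^ a\<^sub>3\<^sub>4, p\<^sub>6, p\<^sub>7]"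
proof -
  interpret bresinsky_exponents a\<^sub>1 a\<^sub>2 a\<^sub>3 a\<^sub>4 a\<^sub>1\<^sub>3 a\<^sub>1\<^sub>4 a\<^sub>2\<^sub>1 a\<^sub>2\<^sub>3 a\<^sub>3\<^sub>2 a\<^sub>3\<^sub>4 a\<^sub>4\<^sub>1 a\<^sub>4\<^sub>2 .
  let ?F = "{mon l - mon r |l r. (l, r) \<in> binomials} :: 'k mpoly4 set"
  note monomial = var_power mult_single expo4_def
  have f: "f\<^sub>1 = mon (expo4 a\<^sub>1 0 0 0) - mon (expo4 0 0 a\<^sub>1\<^sub>3 a\<^sub>1\<^sub>4)"
    "f\<^sub>2 = mon (expo4 0 a\<^sub>2 0 0) - mon (expo4 a\<^sub>2\<^sub>1 0 a\<^sub>2\<^sub>3 0)"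
    "f\<^sub>3 = mon (expo4 0 0 a\<^sub>3 0) - mon (expo4 0 a\<^sub>3\<^sub>2 0 a\<^sub>3\<^sub>4)"
    "f\<^sub>4 = mon (expo4 0 0 0 a\<^sub>4) - mon (expo4 a\<^sub>4\<^sub>1 a\<^sub>4\<^sub>2 0 0)"
    "f\<^sub>5 = mon (expo4 a\<^sub>2\<^sub>1 0 0 a\<^sub>3\<^sub>4) - mon (expo4 0 a\<^sub>4\<^sub>2 a\<^sub>1\<^sub>3 0)"
    by (simp_all add: f1 f2 f3 f4 f5 monomial)
  have "set [f\<^sub>1, f\<^sub>2, f\<^sub>3, f\<^sub>4, f\<^sub>5] = ?F"
    unfolding f list.set binomials_def by blast
  then have curve_ideal: "curve_ideal n = ideal ?F"
    using f_gens unfolding minimally_generated_by_def by simp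
  have weight: "wt n l = wt n r" if "(l, r) \<in> binomials" for l r
  proof -
    have "(mon l - mon r :: 'k mpoly4) \<in> ideal ?F"
      using that by (intro ideal.span_base) blast
    then show ?thesis
      unfolding curve_ideal[symmetric] by (simp only: binomial_in_curve_ideal)
  qed
  \<comment> \<open>Here it enters that the \<open>f_j\<close> generate I(C): the difference of two
    monomials of equal weight lies in I(C), hence in the ideal of the five binomials.\<close>
  have connected: "equivclp (rstep binomials) u v" if "wt n u = wt n v" for u v
  proof (rule binomial_ideal_equiv)
    show "(mon u - mon v :: 'k mpoly4) \<in> ideal ?F"
      unfolding curve_ideal[symmetric] using that by (simp only: binomial_in_curve_ideal)
  qed
  have n_pos': "0 < n I2" "0 < n I3" "0 < n I4" and a_pos: "0 < a\<^sub>3" "0 < a\<^sub>4"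
    using n_pos n_less a_gt_1 by linarith+
  have rules: "gorenstein_rules a\<^sub>1 a\<^sub>2 a\<^sub>3 a\<^sub>4 a\<^sub>1\<^sub>3 a\<^sub>1\<^sub>4 a\<^sub>2\<^sub>1 a\<^sub>2\<^sub>3 a\<^sub>3\<^sub>2 a\<^sub>3\<^sub>4 a\<^sub>4\<^sub>1 a\<^sub>4\<^sub>2 n"
    by unfold_locales
      (fact n_pos n_pos' n_less a13 a14 a21 a23 a32 a34 a41 a42 a_pos
          case_5 case_14 cond_2 cond_3 cond_6 |
        (rule weight, assumption) | (rule connected, assumption))+
  have p: "p\<^sub>2 = (if a\<^sub>2 < a\<^sub>2\<^sub>1 + a\<^sub>2\<^sub>3 then mon (expo4 0 a\<^sub>2 0 0)
      else mon (expo4 0 a\<^sub>2 0 0) - mon (expo4 a\<^sub>2\<^sub>1 0 a\<^sub>2\<^sub>3 0))"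
    "p\<^sub>3 = (if a\<^sub>3\<^sub>2 + a\<^sub>3\<^sub>4 < a\<^sub>3 then mon (expo4 0 a\<^sub>3\<^sub>2 0 a\<^sub>3\<^sub>4)
      else mon (expo4 0 0 a\<^sub>3 0) - mon (expo4 0 a\<^sub>3\<^sub>2 0 a\<^sub>3\<^sub>4))"
    "p\<^sub>6 = (if a\<^sub>3 + a\<^sub>1\<^sub>3 < a\<^sub>1 + a\<^sub>3\<^sub>2 + a\<^sub>3\<^sub>4 - a\<^sub>1\<^sub>4 then mon (expo4 0 0 (a\<^sub>3 + a\<^sub>1\<^sub>3) 0)
      else mon (expo4 0 0 (a\<^sub>3 + a\<^sub>1\<^sub>3) 0) - mon (expo4 a\<^sub>1 a\<^sub>3\<^sub>2 0 (a\<^sub>3\<^sub>4 - a\<^sub>1\<^sub>4)))"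
    "p\<^sub>7 = (if a\<^sub>2 = a\<^sub>2\<^sub>1 + a\<^sub>2\<^sub>3 \<and> a\<^sub>3 + a\<^sub>1\<^sub>3 = a\<^sub>1 + a\<^sub>3\<^sub>2 + a\<^sub>3\<^sub>4 - a\<^sub>1\<^sub>4
      then mon (expo4 (a\<^sub>1 + a\<^sub>2\<^sub>1) 0 0 (a\<^sub>3\<^sub>4 - a\<^sub>1\<^sub>4)) - mon (expo4 0 a\<^sub>4\<^sub>2 (2 * a\<^sub>1\<^sub>3) 0)
      else mon (expo4 0 a\<^sub>4\<^sub>2 (2 * a\<^sub>1\<^sub>3) 0))"
    unfolding p2 p3 p6 p7 by (simp_all add: monomial)
  have m: "x\<^sub>3 ^ a\<^sub>1\<^sub>3 * x\<^sub>4 ^ a\<^sub>1\<^sub>4 = (mon (expo4 0 0 a\<^sub>1\<^sub>3 a\<^sub>1\<^sub>4) :: 'k mpoly4)"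
    "x\<^sub>4 ^ a\<^sub>4 = (mon (expo4 0 0 0 a\<^sub>4) :: 'k mpoly4)"
    "x\<^sub>1 ^ a\<^sub>2\<^sub>1 * x\<^sub>4 ^ a\<^sub>3\<^sub>4 = (mon (expo4 a\<^sub>2\<^sub>1 0 0 a\<^sub>3\<^sub>4) :: 'k mpoly4)"
    by (simp_all add: monomial)
  show ?thesis
    unfolding m by (rule gorenstein_rules.initial_ideal_minimal_generators[OF rules p])
qed

end
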